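(* Let $K$ be a field of characteristic zero, $x$ a free variable, $I$ an ideal of $K[x]$, and $\delta$ a $K$-derivation or $K$-$\mathcal{E}$-derivation of $K[x]$. Then $\delta(I)$ is a Mathieu subspace of $K[x]$ if one of the following conditions holds: 1) $\delta$ is a locally nilpotent $K$-derivation of $K[x]$; 2) $\delta=\mathrm{id}-\phi$ for some $K$-algebra endomorphism $\phi$ of $K[x]$ with $\deg\phi(x)\ge 2$; 3) $\delta=\mathrm{id}-\phi$ for some $K$-algebra endomorphism $\phi$ of $K[x]$ with $\phi(x)=x+c$ for some $c\in K$, and $I=uK[x]$ where either $u=0$, or $\deg u\le 1$, or $u$ has at least one repeated root in the algebraic closure of $K$.
   Context: $\mathrm{id}$ denotes the identity map of $K[x]$. A $K$-linear map $\eta$ is locally nilpotent if for each $a$ there is $m\ge1$ with $\eta^m(a)=0$. A $K$-derivation $D$ of $K[x]$ is a $K$-linear map with $D(fg)=D(f)g+fD(g)$. A $K$-$\mathcal{E}$-derivation of $K[x]$ is a map of the form $\mathrm{id}-\phi$ with $\phi$ a $K$-algebra endomorphism of $K[x]$. A $K$-subspace $V$ of a commutative $K$-algebra $\mathcal{A}$ is a Mathieu subspace if for all $a,b\in\mathcal{A}$ with $a^m\in V$ for all $m\ge 1$, one has $a^mb\in V$ for all $m\gg 0$. *)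

theory Defs
  imports "HOL-Algebra.Algebraic_Closure_Type"
begin

definition poly_ideal :: "'a::field poly set \<Rightarrow> bool" where
  "poly_ideal I \<longleftrightarrow> 0 \<in> I \<and> (\<forall>f\<in>I. \<forall>g\<in>I. f + g \<in> I) \<and> (\<forall>f\<in>I. \<forall>g. g * f \<in> I)"

definition K_linear :: "('a::field poly \<Rightarrow> 'a poly) \<Rightarrow> bool" where
  "K_linear h \<longleftrightarrow> (\<forall>f g. h (f + g) = h f + h g) \<and> (\<forall>c f. h (smult c f) = smult c (h f))"

definition K_derivation :: "('a::field poly \<Rightarrow> 'a poly) \<Rightarrow> bool" where
  "K_derivation D \<longleftrightarrow> K_linear D \<and> (\<forall>f g. D (f * g) = D f * g + f * D g)"

definition K_alg_endo :: "('a::field poly \<Rightarrow> 'a poly) \<Rightarrow> bool" where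
  "K_alg_endo \<phi> \<longleftrightarrow> K_linear \<phi> \<and> (\<forall>f g. \<phi> (f * g) = \<phi> f * \<phi> g) \<and> \<phi> 1 = 1"

definition K_E_derivation :: "('a::field poly \<Rightarrow> 'a poly) \<Rightarrow> bool" where
  "K_E_derivation \<delta> \<longleftrightarrow> (\<exists>\<phi>. K_alg_endo \<phi> \<and> \<delta> = (\<lambda>f. f - \<phi> f))"

definition locally_nilpotent :: "('a::field poly \<Rightarrow> 'a poly) \<Rightarrow> bool" where
  "locally_nilpotent \<eta> \<longleftrightarrow> (\<forall>a. \<exists>m\<ge>1. (\<eta> ^^ m) a = 0)"

definition K_subspace :: "'a::field poly set \<Rightarrow> bool" where
  "K_subspace V \<longleftrightarrow> 0 \<in> V \<and> (\<forall>f\<in>V. \<forall>g\<in>V. f + g \<in> V) \<and> (\<forall>c. \<forall>f\<in>V. smult c f \<in> V)"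

definition mathieu_subspace :: "'a::field poly set \<Rightarrow> bool" where
  "mathieu_subspace V \<longleftrightarrow> K_subspace V \<and>
     (\<forall>a b. (\<forall>m\<ge>1. a ^ m \<in> V) \<longrightarrow> (\<exists>N. \<forall>m\<ge>N. a ^ m * b \<in> V))"

end

theory Submission
  imports Defs
begin

text \<open>
  Except when the image \<open>V\<close> of \<open>I\<close> is an ideal, \<open>a\<^sup>m \<in> V\<close> for all \<open>m \<ge> 1\<close> forces \<open>a = 0\<close>.

  For \<open>\<delta> = d/dx\<close> and a generator \<open>u\<close> of \<open>I\<close> with two distinct roots \<open>r\<close>, \<open>r'\<close>, the integrals of
  all \<open>a\<^sup>m\<close> from \<open>r\<close> to \<open>r'\<close> vanish; if \<open>u\<close> has at most one root, then \<open>V\<close> is an ideal. For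
  \<open>\<delta> = id - \<phi>\<close> with \<open>\<phi>(x) = x + c\<close>, \<open>c \<noteq> 0\<close>, and \<open>u\<close> with a repeated root, the functional \<open>\<delta> f \<mapsto> f'(\<alpha>)\<close>, which
  is given by Bernoulli numbers, vanishes on all \<open>a\<^sup>m\<close>; if \<open>deg u \<le> 1\<close>, then \<open>V = K[x]\<close>. In both
  cases a valuation ring \<open>R\<close> with residue characteristic \<open>p > deg a\<close>, in which some multiple of \<open>a\<close> has a
  non-constant reduction, shows that \<open>a\<close> is constant: the integral is not in \<open>R\<close> for suitable \<open>m\<close>,
  and \<open>p\<close> times the Bernoulli functional is congruent to \<open>f \<mapsto> f(0) + \<dots> + f(p - 1)\<close>, so that the
  power sums of the values of \<open>a\<close> on \<open>\<int>/p\<close> all vanish, which makes \<open>a\<close> constant there.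

  If \<open>deg \<phi>(x) \<ge> 2\<close>, then a degree count for \<open>a\<close> and \<open>a\<^sup>2\<close> shows that the \<open>g\<close> with \<open>a = g - \<phi>(g)\<close> lies in the
  image of \<open>\<phi>\<close>, and one descends on the degree of \<open>g\<close>.
\<close>

section \<open>Valuation subrings\<close>

locale unital_subring =
  fixes R :: "'a::field set"
  assumes one_closed: "1 \<in> R"
    and diff_closed: "x \<in> R \<Longrightarrow> y \<in> R \<Longrightarrow> x - y \<in> R"
    and mult_closed: "x \<in> R \<Longrightarrow> y \<in> R \<Longrightarrow> x * y \<in> R"
begin

lemma zero_closed: "0 \<in> R"
  using diff_closed[OF one_closed one_closed] by simp

lemma uminus_closed: "x \<in> R \<Longrightarrow> - x \<in> R"
  using diff_closed[OF zero_closed] by simp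

lemma add_closed: "x \<in> R \<Longrightarrow> y \<in> R \<Longrightarrow> x + y \<in> R"
  using diff_closed[of x "- y"] uminus_closed by simp

lemma sum_closed: "(\<And>i. i \<in> A \<Longrightarrow> f i \<in> R) \<Longrightarrow> sum f A \<in> R"
  by (induction A rule: infinite_finite_induct) (auto intro: zero_closed add_closed)

lemma power_closed: "x \<in> R \<Longrightarrow> x ^ n \<in> R"
  by (induction n) (auto intro: one_closed mult_closed)

lemma of_nat_closed: "of_nat n \<in> R"
  by (induction n) (auto intro: zero_closed one_closed add_closed)

lemma of_int_closed: "of_int n \<in> R"
  by (cases n rule: int_cases2) (auto intro: of_nat_closed uminus_closed)

definition polys :: "'a poly set"
  where "polys = {f. \<forall>i. coeff f i \<in> R}"

lemma coeff_closed: "f \<in> polys \<Longrightarrow> coeff f i \<in> R"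
  by (simp add: polys_def)

lemma polys_0: "0 \<in> polys"
  by (simp add: polys_def zero_closed)

lemma polys_pCons: "pCons a f \<in> polys \<longleftrightarrow> a \<in> R \<and> f \<in> polys"
proof -
  have "(\<forall>i. coeff (pCons a f) i \<in> R) \<longleftrightarrow> a \<in> R \<and> (\<forall>i. coeff f i \<in> R)"
    by (metis coeff_pCons_0 coeff_pCons_Suc not0_implies_Suc)
  then show ?thesis by (simp add: polys_def)
qed

lemma polys_1: "1 \<in> polys"
  by (simp add: one_pCons polys_pCons polys_0 one_closed)

lemma polys_monom: "a \<in> R \<Longrightarrow> monom a n \<in> polys"
  by (simp add: polys_def zero_closed)

lemma polys_diff: "f \<in> polys \<Longrightarrow> g \<in> polys \<Longrightarrow> f - g \<in> polys"
  by (simp add: polys_def diff_closed)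

lemma polys_add: "f \<in> polys \<Longrightarrow> g \<in> polys \<Longrightarrow> f + g \<in> polys"
  by (simp add: polys_def add_closed)

lemma polys_mult: "f \<in> polys \<Longrightarrow> g \<in> polys \<Longrightarrow> f * g \<in> polys"
  by (simp add: polys_def coeff_mult sum_closed mult_closed)

lemma polys_smult: "a \<in> R \<Longrightarrow> g \<in> polys \<Longrightarrow> smult a g \<in> polys"
  by (simp add: polys_def mult_closed)

lemma polys_power: "f \<in> polys \<Longrightarrow> f ^ n \<in> polys"
  by (induction n) (auto intro: polys_1 polys_mult)

lemma prod_closed: "(\<And>i. i \<in> A \<Longrightarrow> f i \<in> R) \<Longrightarrow> prod f A \<in> R"
  by (induction A rule: infinite_finite_induct) (auto intro: one_closed mult_closed)

lemma polys_prod: "(\<And>i. i \<in> A \<Longrightarrow> f i \<in> polys) \<Longrightarrow> prod f A \<in> polys"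
  by (induction A rule: infinite_finite_induct) (auto intro: polys_1 polys_mult)

lemma poly_closed: "f \<in> polys \<Longrightarrow> x \<in> R \<Longrightarrow> poly f x \<in> R"
  by (simp add: poly_altdef sum_closed mult_closed power_closed coeff_closed)

lemma polys_reflect: "f \<in> polys \<Longrightarrow> reflect_poly f \<in> polys"
  by (simp add: polys_def coeff_reflect_poly zero_closed)

definition adjoin :: "'a \<Rightarrow> 'a set"
  where "adjoin z = (\<lambda>f. poly f z) ` polys"

lemma adjoin_subring: "unital_subring (adjoin z)"
proof
  show "1 \<in> adjoin z"
    unfolding adjoin_def by (rule image_eqI[OF _ polys_1]) simp
next
  fix x y assume "x \<in> adjoin z" "y \<in> adjoin z"
  then obtain f g where fg: "f \<in> polys" "g \<in> polys" "x = poly f z" "y = poly g z"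
    by (auto simp: adjoin_def)
  show "x - y \<in> adjoin z"
    unfolding adjoin_def by (rule image_eqI[OF _ polys_diff[OF fg(1,2)]]) (simp add: fg)
  show "x * y \<in> adjoin z"
    unfolding adjoin_def by (rule image_eqI[OF _ polys_mult[OF fg(1,2)]]) (simp add: fg)
qed

lemma adjoin_superset: "R \<subseteq> adjoin z"
proof
  fix a assume "a \<in> R"
  then have "[:a:] \<in> polys" by (simp add: polys_pCons polys_0)
  then show "a \<in> adjoin z"
    unfolding adjoin_def by (rule image_eqI[rotated]) simp
qed

lemma adjoin_gen: "z \<in> adjoin z"
proof -
  have "[:0, 1:] \<in> polys" by (simp add: polys_pCons polys_0 zero_closed one_closed)
  then show ?thesis
    unfolding adjoin_def by (rule image_eqI[rotated]) simp
qed

end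

locale valuation_subring = unital_subring +
  assumes total: "x \<in> R \<or> inverse x \<in> R"
begin

text \<open>The maximal ideal, as the set of nonunits of \<open>R\<close>. Since
  \<open>inverse 0 = 0\<close> lies in \<open>R\<close>, the element 0 has to be listed
  separately.\<close>

definition M :: "'a set"
  where "M = {x \<in> R. x = 0 \<or> inverse x \<notin> R}"

lemma M_0: "0 \<in> M"
  by (simp add: M_def zero_closed)

lemma unit_inverse: "x \<in> R \<Longrightarrow> x \<notin> M \<Longrightarrow> inverse x \<in> R"
  by (simp add: M_def)

lemma one_notin_M: "1 \<notin> M"
  by (simp add: M_def one_closed)

lemma M_mult:
  assumes "x \<in> M" "y \<in> R" shows "x * y \<in> M"
proof (cases "x * y = 0")
  case True then show ?thesis by (metis M_0)
next
  case False
  have "inverse (x * y) \<notin> R"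
  proof
    assume "inverse (x * y) \<in> R"
    then have "y * inverse (x * y) \<in> R" using assms by (intro mult_closed)
    also have "y * inverse (x * y) = inverse x" using False by (simp add: field_simps)
    finally show False using assms False by (simp add: M_def)
  qed
  then show ?thesis using assms by (simp add: M_def mult_closed)
qed

lemma M_mult': "x \<in> R \<Longrightarrow> y \<in> M \<Longrightarrow> x * y \<in> M"
  using M_mult[of y x] by (simp add: mult.commute)

lemma M_prime:
  assumes "x \<in> R" "y \<in> R" "x * y \<in> M" shows "x \<in> M \<or> y \<in> M"
proof (rule ccontr)
  assume "\<not> ?thesis"
  then have n: "x \<notin> M" "y \<notin> M" by auto
  then have "x \<noteq> 0" "y \<noteq> 0" using M_0 by auto
  moreover have "inverse x * inverse y \<in> R"
    using n assms by (intro mult_closed unit_inverse)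
  ultimately show False using assms(3) by (simp add: M_def)
qed

lemma M_uminus: "x \<in> M \<Longrightarrow> - x \<in> M"
  using M_mult[of x "- 1"] uminus_closed[OF one_closed] by simp

text \<open>By \<open>total\<close>, one of \<open>x / y\<close> and \<open>y / x\<close> lies in
  \<open>R\<close>; factoring out the denominator exhibits the sum as an element of \<open>M\<close>
  times an element of \<open>R\<close>.\<close>

lemma M_add:
  assumes x: "x \<in> M" and y: "y \<in> M" shows "x + y \<in> M"
proof -
  have *: "u + v \<in> M" if "u \<in> M" "v \<in> M" "v \<noteq> 0" "u * inverse v \<in> R" for u v
  proof -
    have "v * (u * inverse v + 1) \<in> M"
      using that by (intro M_mult add_closed one_closed)
    moreover have "v * (u * inverse v + 1) = u + v" using that by (simp add: field_simps)
    ultimately show ?thesis by simp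
  qed
  show ?thesis
  proof (cases "x = 0 \<or> y = 0")
    case True then show ?thesis using x y by auto
  next
    case False
    have eq: "inverse (x * inverse y) = y * inverse x" using False by (simp add: field_simps)
    then consider "x * inverse y \<in> R" | "y * inverse x \<in> R"
      using total[of "x * inverse y"] unfolding eq by blast
    then show ?thesis
      by cases (use *[of x y] *[of y x] x y False in \<open>auto simp: add.commute\<close>)
  qed
qed

lemma M_diff: "x \<in> M \<Longrightarrow> y \<in> M \<Longrightarrow> x - y \<in> M"
  using M_add[of x "- y"] M_uminus by simp

lemma M_sum: "(\<And>i. i \<in> A \<Longrightarrow> f i \<in> M) \<Longrightarrow> sum f A \<in> M"
  by (induction A rule: infinite_finite_induct) (auto intro: M_0 M_add)

lemma M_prod: "finite A \<Longrightarrow> (\<And>i. i \<in> A \<Longrightarrow> f i \<in> R) \<Longrightarrow> prod f A \<in> M \<Longrightarrow> \<exists>i\<in>A. f i \<in> M"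
proof (induction A rule: finite_induct)
  case empty then show ?case by (simp add: one_notin_M)
next
  case (insert a A)
  have "prod f A \<in> R" using insert by (intro prod_closed) auto
  then show ?case using insert M_prime[of "f a" "prod f A"] by auto
qed

end

text \<open>Chevalley's extension argument: a subring that is maximal with respect to not containing
  \<open>1/p\<close> is a valuation ring.\<close>

lemma exists_valuation_subring:
  fixes A :: "'a::field set"
  assumes A: "unital_subring A" and pA: "p \<in> A" and ip: "inverse p \<notin> A"
  obtains R where "valuation_subring R" "A \<subseteq> R" "p \<in> valuation_subring.M R"
proof -
  define F where "F = {R. unital_subring R \<and> A \<subseteq> R \<and> inverse p \<notin> R}"
  have "\<exists>R\<in>F. \<forall>Z\<in>F. R \<subseteq> Z \<longrightarrow> Z = R"
  proof (rule subset_Zorn_nonempty)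
    show "F \<noteq> {}" using A ip by (auto simp: F_def)
  next
    fix C assume C: "C \<noteq> {}" "subset.chain F C"
    then have CF: "C \<subseteq> F" by (simp add: subset_chain_def)
    have common: "\<exists>Z\<in>C. x \<in> Z \<and> y \<in> Z" if "x \<in> \<Union>C" "y \<in> \<Union>C" for x y
      using that C(2) unfolding subset_chain_def by (metis UnionE subsetD)
    have "unital_subring (\<Union>C)"
    proof
      show "1 \<in> \<Union>C" using C(1) CF by (auto simp: F_def intro: unital_subring.one_closed)
    next
      fix x y assume "x \<in> \<Union>C" "y \<in> \<Union>C"
      then obtain Z where Z: "Z \<in> C" "x \<in> Z" "y \<in> Z" using common by blast
      interpret Z: unital_subring Z using Z CF by (auto simp: F_def)
      show "x - y \<in> \<Union>C" using Z Z.diff_closed by blast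
      show "x * y \<in> \<Union>C" using Z Z.mult_closed by blast
    qed
    then show "\<Union>C \<in> F" using C(1) CF by (auto simp: F_def)
  qed
  then obtain R where RF: "R \<in> F" and max: "\<And>Z. Z \<in> F \<Longrightarrow> R \<subseteq> Z \<Longrightarrow> Z = R" by blast
  interpret unital_subring R using RF by (simp add: F_def)
  have AR: "A \<subseteq> R" and ipR: "inverse p \<notin> R" using RF by (auto simp: F_def)
  have pR: "p \<in> R" using pA AR by auto
  have p0: "p \<noteq> 0" using ipR zero_closed by auto
  have nounit: "p * b \<noteq> 1" if "b \<in> R" for b
  proof
    assume "p * b = 1"
    then have "inverse p = b" by (rule inverse_unique)
    then show False using that ipR by simp
  qed
  \<comment> \<open>By maximality of \<open>R\<close>, the strictly larger ring
    \<open>adjoin z\<close> contains \<open>1/p\<close>.\<close>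
  have ext: "\<exists>g\<in>polys. p * poly g z = 1" if "z \<notin> R" for z
  proof -
    have "adjoin z \<noteq> R" using adjoin_gen[of z] that by auto
    then have "adjoin z \<notin> F" using max[OF _ adjoin_superset] by auto
    then have "inverse p \<in> adjoin z" using adjoin_subring adjoin_superset[of z] AR by (auto simp: F_def)
    then show ?thesis using p0 by (auto simp: adjoin_def intro!: bexI simp flip: right_inverse)
  qed
  \<comment> \<open>For \<open>w = 1 - p b\<close> with \<open>1/w\<close> outside \<open>R\<close>,
    \<open>ext\<close> gives \<open>p g(1/w) = 1\<close>. Multiplying by \<open>w^deg g\<close> puts
    this power into \<open>p R\<close>, while every power of \<open>w\<close> has the form
    \<open>1 - p c\<close>; so \<open>p\<close> would be a unit.\<close>
  have unit: "inverse (1 - p * b) \<in> R" if b: "b \<in> R" for b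
  proof (rule ccontr)
    define w where "w = 1 - p * b"
    assume "inverse (1 - p * b) \<notin> R"
    then obtain g where g: "g \<in> polys" "p * poly g (inverse w) = 1"
      using ext unfolding w_def by blast
    have w0: "w \<noteq> 0" using nounit[OF b] by (simp add: w_def)
    have "p * poly (reflect_poly g) w = w ^ degree g"
      using poly_reflect_poly_nz[OF w0, of g] g(2) by (simp add: mult.left_commute)
    moreover have "\<exists>c\<in>R. w ^ n = 1 - p * c" for n
    proof (induction n)
      case 0 show ?case by (rule bexI[OF _ zero_closed]) simp
    next
      case (Suc n)
      then obtain c where c: "c \<in> R" "w ^ n = 1 - p * c" by blast
      have "b + c - p * b * c \<in> R" using b c pR by (intro diff_closed add_closed mult_closed)
      moreover have "w ^ Suc n = (1 - p * b) * (1 - p * c)"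
        using c(2) by (simp add: w_def)
      then have "w ^ Suc n = 1 - p * (b + c - p * b * c)"
        by (simp add: algebra_simps)
      ultimately show ?case by blast
    qed
    moreover have "w \<in> R" using b pR unfolding w_def by (intro diff_closed one_closed mult_closed)
    ultimately obtain c where c: "c \<in> R" "p * poly (reflect_poly g) w = 1 - p * c"
      by metis
    then have "p * (poly (reflect_poly g) w + c) = 1" by (simp add: algebra_simps)
    then show False
      using nounit add_closed c(1) poly_closed[OF polys_reflect[OF g(1)] \<open>w \<in> R\<close>] by blast
  qed
  define S where "S z n \<longleftrightarrow> (\<exists>g\<in>polys. degree g \<le> n \<and> p * poly g z = 1)" for z n
  have S0: "\<not> S z 0" for z
  proof
    assume "S z 0"
    then obtain g where "g \<in> polys" "degree g = 0" "p * poly g z = 1" by (auto simp: S_def)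
    then show False using nounit coeff_closed
      by (metis degree_0_id poly_const_conv)
  qed
  \<comment> \<open>Chevalley's degree reduction: the relation for \<open>1/z\<close>, solved for
    its constant term, expresses \<open>z^m\<close> as \<open>p\<close> times a polynomial in
    \<open>z\<close> of degree less than \<open>m\<close>, which then replaces the top term of the
    relation for \<open>z\<close>.\<close>
  have shrink: "\<exists>k<n. S z k" if z: "z \<noteq> 0" and n: "S z n" and m: "S (inverse z) m" and "m \<le> n" for z m n
  proof -
    obtain g h where g: "g \<in> polys" "degree g \<le> n" "p * poly g z = 1"
      and h: "h \<in> polys" "degree h \<le> m" "p * poly h (inverse z) = 1"
      using n m by (auto simp: S_def)
    obtain b e where be: "h = pCons b e" by (cases h)
    have b: "b \<in> R" and e: "e \<in> polys" using h(1) by (auto simp: be polys_pCons)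
    have "m \<noteq> 0" using S0 m by metis
    have dege: "degree e \<le> m - 1" using h(2) by (auto simp: be split: if_splits)
    define w where "w = 1 - p * b"
    define q where "q = smult (inverse w) (monom 1 (m - 1 - degree e) * reflect_poly e)"
    have w0: "w \<noteq> 0" using nounit[OF b] by (simp add: w_def)
    have "q \<in> polys" unfolding q_def w_def
      using unit[OF b] e by (intro polys_smult polys_mult polys_monom polys_reflect one_closed)
    have "degree q \<le> (m - 1 - degree e) + degree e"
      unfolding q_def
      by (intro order.trans[OF degree_smult_le] order.trans[OF degree_mult_le] add_mono degree_monom_le degree_reflect_poly_le)
    then have degq: "degree q < m" using dege \<open>m \<noteq> 0\<close> by simp
    have "w = p * (inverse z * poly e (inverse z))"
      using h(3) by (simp add: be w_def algebra_simps)
    then have "w * z ^ m = p * (z ^ (m - 1) * poly e (inverse z))"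
      using z \<open>m \<noteq> 0\<close> by (cases m) (simp_all add: field_simps)
    also have "z ^ (m - 1) * poly e (inverse z) = z ^ (m - 1 - degree e) * poly (reflect_poly e) z"
    proof -
      have "z ^ (m - 1) = z ^ (m - 1 - degree e) * z ^ degree e"
        using dege by (simp only: le_add_diff_inverse2 flip: power_add)
      then show ?thesis by (simp only: poly_reflect_poly_nz[OF z] mult.assoc)
    qed
    finally have zm: "z ^ m = p * poly q z"
      using w0 by (simp add: q_def poly_monom field_simps)
    define a where "a = coeff g n"
    define g' where "g' = g - monom a n + smult (p * a) (monom 1 (n - m) * q)"
    have "a \<in> R" using g by (simp add: a_def coeff_closed)
    have "g' \<in> polys" unfolding g'_def using g(1) \<open>a \<in> R\<close> \<open>q \<in> polys\<close> pR
      by (intro polys_add polys_diff polys_smult polys_mult polys_monom mult_closed one_closed)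
    have "poly g' z = poly g z - a * z ^ n + a * z ^ (n - m) * z ^ m"
      by (simp add: g'_def poly_monom zm)
    also have "\<dots> = poly g z" using \<open>m \<le> n\<close> by (simp flip: power_add mult.assoc)
    finally have "p * poly g' z = 1" using g(3) by simp
    have "coeff g' k = 0" if "k \<ge> n" for k
    proof -
      have "degree (monom 1 (n - m) * q) < n"
        using degree_mult_le[of "monom 1 (n - m)" q] degree_monom_le[of "1::'a" "n-m"] degq \<open>m \<le> n\<close> by linarith
      then have "coeff (monom 1 (n - m) * q) k = 0" using that by (intro coeff_eq_0) simp
      moreover have "coeff (g - monom a n) k = 0"
        using that g(2) by (cases "k = n") (auto simp: a_def intro: coeff_eq_0)
      ultimately show ?thesis by (simp add: g'_def)
    qed
    moreover have "n > 0" using \<open>m \<noteq> 0\<close> \<open>m \<le> n\<close> by simp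
    ultimately have "degree g' < n" by (metis leading_coeff_0_iff degree_0 not_le)
    then show ?thesis using \<open>g' \<in> polys\<close> \<open>p * poly g' z = 1\<close> by (auto simp: S_def)
  qed
  have "valuation_subring R"
  proof
    fix z show "z \<in> R \<or> inverse z \<in> R"
    proof (rule ccontr)
      assume n: "\<not> ?thesis"
      then have z: "z \<noteq> 0" using zero_closed by auto
      have ex: "\<exists>n. S z n" "\<exists>n. S (inverse z) n" using n ext by (force simp: S_def)+
      \<comment> \<open>Minimal degrees of relations for \<open>z\<close> and \<open>1/z\<close>;
        \<open>shrink\<close> lowers the larger of the two.\<close>
      define k where "k = (LEAST n. S z n)"
      define l where "l = (LEAST n. S (inverse z) n)"
      have k: "S z k" and l: "S (inverse z) l" unfolding k_def l_def using ex by (auto intro: LeastI_ex)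
      have "\<not> S z i" if "i < k" for i using that not_less_Least unfolding k_def by blast
      moreover have "\<not> S (inverse z) i" if "i < l" for i using that not_less_Least unfolding l_def by blast
      moreover have "inverse z \<noteq> 0" using z by simp
      ultimately show False
        using shrink[OF z k l] shrink[of "inverse z" l k] k l
        by (metis inverse_inverse_eq nle_le)
    qed
  qed
  then show thesis using that AR pR ipR by (simp add: valuation_subring.M_def)
qed

section \<open>Primes that stay non-invertible in the ring generated by one element\<close>

lemma map_poly_of_int_add: "map_poly of_int (f + g) = (map_poly of_int f + map_poly of_int g :: 'a::ring_1 poly)"
  by (rule poly_eqI) (simp add: coeff_map_poly)

lemma map_poly_of_int_diff: "map_poly of_int (f - g) = (map_poly of_int f - map_poly of_int g :: 'a::ring_1 poly)"
  by (rule poly_eqI) (simp add: coeff_map_poly)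

lemma map_poly_of_int_mult: "map_poly of_int (f * g) = (map_poly of_int f * map_poly of_int g :: 'a::comm_ring_1 poly)"
  by (rule poly_eqI) (simp add: coeff_map_poly coeff_mult)

lemma map_poly_of_int_smult: "map_poly of_int (smult c g) = (smult (of_int c) (map_poly of_int g) :: 'a::comm_ring_1 poly)"
  by (rule poly_eqI) (simp add: coeff_map_poly)

lemmas map_poly_of_int_simps = map_poly_of_int_add map_poly_of_int_diff map_poly_of_int_mult map_poly_of_int_smult

text \<open>If \<open>x\<close> is transcendental, no prime is inverted. Otherwise take an integer
  polynomial \<open>q\<close> of least degree with root \<open>x\<close>, its leading coefficient
  \<open>a\<close>, and a prime \<open>p > |a|\<close>. From \<open>p g(x) = 1\<close>,
  pseudo-division of \<open>1 - p g\<close> by \<open>q\<close> gives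
  \<open>q h = a^k (1 - p g)\<close>. Modulo \<open>p\<close> the right side is constant, so
  \<open>h\<close> vanishes modulo \<open>p\<close>, and \<open>p\<close> divides
  \<open>a^k\<close>, a contradiction.\<close>

lemma exists_prime_inverse_notin_adjoin_int:
  fixes x :: "'a::field_char_0"
  obtains p where "prime p" "p > N" "\<And>g :: int poly. of_nat p * poly (map_poly of_int g) x \<noteq> 1"
proof -
  define ev :: "int poly \<Rightarrow> 'a" where "ev g = poly (map_poly of_int g) x" for g
  have ev: "ev (f + g) = ev f + ev g" "ev (f - g) = ev f - ev g" "ev (f * g) = ev f * ev g"
    "ev (smult c f) = of_int c * ev f" "ev 1 = 1" "ev 0 = 0" for f g c
    by (simp_all add: ev_def map_poly_of_int_simps)
  have key: "\<exists>p. prime p \<and> p > N \<and> (\<forall>g. of_nat p * ev g \<noteq> 1)"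
  proof (cases "\<exists>q. q \<noteq> 0 \<and> ev q = 0")
    case False
    obtain p where p: "prime p" "p > N" using bigger_prime by blast
    have "of_nat p * ev g \<noteq> 1" for g
    proof
      assume "of_nat p * ev g = 1"
      then have "ev (1 - smult (int p) g) = 0" by (simp add: ev)
      then have "1 - smult (int p) g = 0" using False by blast
      then have "coeff (1 - smult (int p) g) 0 = 0" by simp
      then have "int p * coeff g 0 = 1" by simp
      then have "int p dvd 1" by (metis dvd_triv_left)
      then show False using p by auto
    qed
    then show ?thesis using p by blast
  next
    case True
    then obtain q where q: "q \<noteq> 0" "ev q = 0" and min: "\<And>r. r \<noteq> 0 \<Longrightarrow> ev r = 0 \<Longrightarrow> degree q \<le> degree r"
      using exists_least_iff[of "\<lambda>n. \<exists>q. q \<noteq> 0 \<and> ev q = 0 \<and> degree q = n"]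
      by (metis (mono_tags, lifting) linorder_not_less)
    define n where "n = degree q"
    define a where "a = coeff q n"
    have a0: "a \<noteq> 0" using q by (simp add: a_def n_def)
    have n0: "n > 0"
    proof (rule ccontr)
      assume "\<not> n > 0"
      then obtain c where "q = [:c:]" using degree_eq_zeroE[of q] by (auto simp: n_def)
      then show False using q by (simp add: ev_def map_poly_pCons)
    qed
    obtain p where p: "prime p" "p > N + nat \<bar>a\<bar>" using bigger_prime by blast
    have pa: "\<not> int p dvd a"
      using zdvd_imp_le[of "int p" "\<bar>a\<bar>"] a0 p(2) by auto
    have pp: "prime (int p)" using p by simp
    have "of_nat p * ev g \<noteq> 1" for g
    proof
      assume g: "of_nat p * ev g = 1"
      define f where "f = 1 - smult (int p) g"
      have "ev f = 0" using g by (simp add: f_def ev)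
      obtain h r where hr: "pseudo_divmod f q = (h, r)" by (cases "pseudo_divmod f q")
      define k where "k = Suc (degree f) - degree q"
      have div: "smult (a ^ k) f = q * h + r" "r = 0 \<or> degree r < degree q"
        using pseudo_divmod[OF q(1) hr] by (simp_all add: a_def n_def k_def)
      have "ev r = ev (smult (a ^ k) f) - ev (q * h)" by (simp add: div ev)
      also have "\<dots> = 0" using \<open>ev f = 0\<close> q by (simp only: ev) simp
      finally have "r = 0" using div(2) min[of r] by force
      have eq: "q * h = smult (a ^ k) f" using div \<open>r = 0\<close> by simp
      \<comment> \<open>Downward induction on \<open>j\<close>: the coefficient of
        \<open>q h\<close> at \<open>n + j > 0\<close> is divisible by \<open>p\<close>, and apart
        from \<open>a * coeff h j\<close> it involves only higher coefficients of
        \<open>h\<close>.\<close>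
      have dvd: "int p dvd coeff h j" for j
      proof (induction "degree h - j" arbitrary: j rule: less_induct)
        case less
        show ?case
        proof (cases "j > degree h")
          case True then show ?thesis by (simp add: coeff_eq_0)
        next
          case False
          have "coeff (q * h) (n + j) = (\<Sum>i\<le>n+j. coeff q i * coeff h (n + j - i))"
            by (rule coeff_mult)
          also have "\<dots> = coeff q n * coeff h j + (\<Sum>i\<in>{..n+j} - {n}. coeff q i * coeff h (n + j - i))"
            by (subst sum.remove[of _ n]) auto
          finally have "a * coeff h j = coeff (q * h) (n + j)
              - (\<Sum>i\<in>{..n+j} - {n}. coeff q i * coeff h (n + j - i))" by (simp add: a_def)
          moreover have "int p dvd coeff (q * h) (n + j)"
            using n0 by (simp add: eq f_def)
          moreover have "int p dvd (\<Sum>i\<in>{..n+j} - {n}. coeff q i * coeff h (n + j - i))"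
          proof (rule dvd_sum)
            fix i assume i: "i \<in> {..n+j} - {n}"
            show "int p dvd coeff q i * coeff h (n + j - i)"
            proof (cases "i > n")
              case True then show ?thesis by (simp add: coeff_eq_0 n_def)
            next
              case F: False
              show ?thesis
              proof (cases "n + j - i > degree h")
                case True then show ?thesis by (simp add: coeff_eq_0)
              next
                case F2: False
                then have "int p dvd coeff h (n + j - i)" using F i by (intro less) auto
                then show ?thesis by simp
              qed
            qed
          qed
          ultimately have "int p dvd a * coeff h j" by (simp only: dvd_diff)
          then show ?thesis using pp pa by (simp add: prime_dvd_mult_iff)
        qed
      qed
      have "a ^ k = coeff (q * h) 0 + int p * (a ^ k * coeff g 0)"
        unfolding eq by (simp add: f_def algebra_simps)
      moreover have "int p dvd coeff (q * h) 0" using dvd[of 0] by (simp add: coeff_mult)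
      ultimately have "int p dvd a ^ k" using dvd_add dvd_triv_left by metis
      then show False using pp pa prime_dvd_power by blast
    qed
    then show ?thesis using p by (intro exI[of _ p]) auto
  qed
  then show thesis using that unfolding ev_def by blast
qed

text \<open>The extension argument, applied to the image of the integer polynomials under evaluation
  at \<open>x\<close>.\<close>

lemma exists_valuation_subring_prime:
  fixes x :: "'a::field_char_0"
  obtains p R where "prime p" "p > N" "valuation_subring R" "of_nat p \<in> valuation_subring.M R" "x \<in> R"
proof -
  obtain p where p: "prime p" "p > N" "\<And>g :: int poly. of_nat p * poly (map_poly of_int g) x \<noteq> 1"
    using exists_prime_inverse_notin_adjoin_int by blast
  define A where "A = range (\<lambda>g :: int poly. poly (map_poly of_int g) x)"
  have "unital_subring A"
  proof
    show "1 \<in> A" unfolding A_def by (rule range_eqI[of _ _ 1]) simp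
  next
    fix y z assume "y \<in> A" "z \<in> A"
    then obtain f g where fg: "y = poly (map_poly of_int f) x" "z = poly (map_poly of_int g) x"
      by (auto simp: A_def)
    show "y - z \<in> A" unfolding A_def by (rule range_eqI[of _ _ "f - g"]) (simp add: fg map_poly_of_int_simps)
    show "y * z \<in> A" unfolding A_def by (rule range_eqI[of _ _ "f * g"]) (simp add: fg map_poly_of_int_simps)
  qed
  moreover have "of_nat p \<in> A"
    unfolding A_def by (rule range_eqI[of _ _ "[:int p:]"]) (simp add: map_poly_pCons)
  moreover have "inverse (of_nat p) \<notin> A"
  proof
    assume "inverse (of_nat p) \<in> A"
    then obtain g :: "int poly" where "inverse (of_nat p) = poly (map_poly of_int g) x" by (auto simp: A_def)
    then show False using p(3)[of g] p(1) by (metis of_nat_eq_0_iff prime_gt_0_nat less_irrefl right_inverse)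
  qed
  ultimately obtain R where R: "valuation_subring R" "A \<subseteq> R" "of_nat p \<in> valuation_subring.M R"
    by (rule exists_valuation_subring)
  have "x \<in> A" unfolding A_def by (rule range_eqI[of _ _ "[:0, 1:]"]) (simp add: map_poly_pCons)
  then show thesis using that p R by blast
qed

section \<open>Normalising a polynomial over a valuation ring\<close>

text \<open>\<open>c j\<close> has the least valuation; dividing by it brings the family into
  \<open>R\<close> with one entry equal to 1.\<close>

lemma (in valuation_subring) exists_dominant:
  assumes "finite A" "A \<noteq> {}" "\<And>k. k \<in> A \<Longrightarrow> c k \<noteq> 0"
  shows "\<exists>j\<in>A. \<forall>k\<in>A. c k / c j \<in> R"
  using assms
proof (induction A rule: finite_ne_induct)
  case (singleton i) then show ?case by (simp add: one_closed)
next
  case (insert i A)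
  then obtain j where j: "j \<in> A" "\<forall>k\<in>A. c k / c j \<in> R" by auto
  have nz: "c i \<noteq> 0" "c j \<noteq> 0" using insert j by auto
  have "inverse (c i / c j) = c j / c i" by simp
  then consider "c i / c j \<in> R" | "c j / c i \<in> R" using total[of "c i / c j"] by fastforce
  then show ?case
  proof cases
    case 1 then show ?thesis using j by auto
  next
    case 2
    have "c k / c i \<in> R" if "k \<in> A" for k
      using mult_closed[of "c k / c j" "c j / c i"] 2 j that nz by simp
    then show ?thesis using nz by (auto simp: one_closed)
  qed
qed

text \<open>Controlling the ratio of the constant and the leading coefficient is enough to make
  the reduction of a suitable multiple of \<open>f\<close> non-constant.\<close>

lemma exists_nonconst_reduction:
  fixes f :: "'a::field_char_0 poly"
  assumes "degree f > 0"
  obtains p R e i where "prime p" "p > N" "valuation_subring R" "of_nat p \<in> valuation_subring.M R"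
    "smult e f \<in> unital_subring.polys R" "0 < i" "i \<le> degree f"
    "coeff (smult e f) i \<notin> valuation_subring.M R"
    "\<And>k. k > i \<Longrightarrow> coeff (smult e f) k \<in> valuation_subring.M R"
proof -
  define d where "d = degree f"
  obtain p R where p: "prime p" "p > N" and "valuation_subring R" and pM: "of_nat p \<in> valuation_subring.M R"
    and x: "coeff f 0 / coeff f d \<in> R"
    by (rule exists_valuation_subring_prime)
  interpret valuation_subring R by fact
  have fd: "coeff f d \<noteq> 0" using assms by (auto simp: d_def)
  obtain j where j: "coeff f j \<noteq> 0" "\<And>k. coeff f k / coeff f j \<in> R"
  proof -
    let ?A = "{k. k \<le> d \<and> coeff f k \<noteq> 0}"
    have "\<exists>j\<in>?A. \<forall>k\<in>?A. coeff f k / coeff f j \<in> R"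
      using fd by (intro exists_dominant) auto
    then obtain j where j: "j \<in> ?A" "\<forall>k\<in>?A. coeff f k / coeff f j \<in> R" by blast
    have "coeff f k / coeff f j \<in> R" for k
      using j zero_closed by (cases "coeff f k = 0") (auto simp: d_def le_degree)
    then show thesis using that j by blast
  qed
  define e where "e = inverse (coeff f j)"
  define g where "g = smult e f"
  have gk: "coeff g k = coeff f k / coeff f j" for k by (simp add: g_def e_def field_simps)
  have gR: "g \<in> polys" using j by (simp add: polys_def gk)
  define i where "i = Max {k. k \<le> d \<and> coeff g k \<notin> M}"
  have fin: "finite {k. k \<le> d \<and> coeff g k \<notin> M}" by simp
  have "j \<in> {k. k \<le> d \<and> coeff g k \<notin> M}"
    using j one_notin_M by (auto simp: gk d_def le_degree)
  then have "i \<in> {k. k \<le> d \<and> coeff g k \<notin> M}"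
    unfolding i_def by (intro Max_in[OF fin]) blast
  then have i: "i \<le> d" "coeff g i \<notin> M" by auto
  have imax: "k \<le> i" if "k \<le> d" "coeff g k \<notin> M" for k
    unfolding i_def using that by (intro Max_ge[OF fin]) simp
  have gt: "coeff g k \<in> M" if "k > i" for k
  proof (cases "k \<le> d")
    case True then show ?thesis using imax that by force
  next
    case False then show ?thesis by (simp add: gk d_def coeff_eq_0 M_0)
  qed
  \<comment> \<open>If \<open>i = 0\<close>, then \<open>coeff g d\<close> lies in \<open>M\<close>,
    hence so does \<open>coeff g 0\<close>, a multiple of it by the choice of \<open>R\<close>; but
    \<open>i = 0\<close> also makes \<open>coeff g 0\<close> a unit.\<close>
  have "i > 0"
  proof (rule ccontr)
    assume "\<not> i > 0"
    then have "coeff g d \<in> M" "coeff g 0 \<notin> M" using gt[of d] i assms by (auto simp: d_def)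
    moreover have "coeff g 0 = coeff g d * (coeff f 0 / coeff f d)"
      using fd by (simp add: gk)
    ultimately show False using M_mult[of "coeff g d"] x by metis
  qed
  then show thesis using that[OF p _ pM, of e i] i gt gR \<open>valuation_subring R\<close>
    by (simp add: g_def d_def)
qed

section \<open>Vanishing integrals of powers\<close>

lemma (in valuation_subring) of_nat_notin_M:
  assumes "prime p" "of_nat p \<in> M" "\<not> p dvd n"
  shows "of_nat n \<notin> M"
proof
  assume n: "of_nat n \<in> M"
  have "coprime p n" using assms by (simp add: prime_imp_coprime)
  then have "gcd (int p) (int n) = 1" by (simp add: coprime_iff_gcd_eq_1 gcd_int_int_eq)
  then obtain u v where uv: "u * int p + v * int n = 1" using bezout_int[of "int p" "int n"] by auto
  have "of_int u * of_nat p + of_int v * of_nat n \<in> M"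
    using assms n by (intro M_add M_mult' of_int_closed)
  also have "of_int u * of_nat p + of_int v * of_nat n = of_int (u * int p + v * int n)" by simp
  finally show False by (simp add: uv one_notin_M)
qed

lemma (in valuation_subring) inverse_of_nat_closed:
  "prime p \<Longrightarrow> of_nat p \<in> M \<Longrightarrow> \<not> p dvd n \<Longrightarrow> inverse (of_nat n) \<in> R"
  by (intro unit_inverse of_nat_closed of_nat_notin_M)

text \<open>Pigeonhole on the residues of \<open>p^n\<close> modulo \<open>i\<close>, then
  cancellation of \<open>p^a\<close>, which is prime to \<open>i\<close>. This supplies the exponent
  \<open>m\<close> with \<open>i m + 1 = p^s\<close>.\<close>

lemma exists_dvd_power_minus_1:
  fixes p i :: nat
  assumes "coprime p i" "p > 0" "i > 0"
  obtains s where "s > 0" "i dvd p ^ s - 1"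
proof -
  have "finite (range (\<lambda>n. p ^ n mod i))"
    by (rule finite_subset[of _ "{..<i}"]) (use assms in auto)
  then have "\<not> inj (\<lambda>n. p ^ n mod i)" using finite_imageD infinite_UNIV_nat by blast
  then obtain x y where "x \<noteq> y" "p ^ x mod i = p ^ y mod i" unfolding inj_def by blast
  then obtain a b where ab: "a < b" "p ^ a mod i = p ^ b mod i"
    using that[of x y] that[of y x] by (cases "x < y") auto
  show thesis
  proof
    show "b - a > 0" using ab by simp
    have pb: "p ^ a * p ^ (b - a) = p ^ b" using ab(1) by (simp flip: power_add)
    have eq: "p ^ b - p ^ a = p ^ a * (p ^ (b - a) - 1)"
      unfolding diff_mult_distrib2 pb by simp
    have "p ^ a \<le> p ^ b" using ab(1) assms(2) by (intro power_increasing) auto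
    then have "i dvd p ^ a * (p ^ (b - a) - 1)"
      using ab(2) mod_eq_dvd_iff_nat[of "p ^ a" "p ^ b" i] eq by simp
    moreover have "coprime i (p ^ a)" using assms(1) by (simp add: coprime_commute)
    ultimately show "i dvd p ^ (b - a) - 1" by (simp only: coprime_dvd_mult_right_iff)
  qed
qed

section \<open>Degree of the reduction modulo the maximal ideal\<close>

context valuation_subring
begin

text \<open>\<open>i\<close> is the degree of the image of \<open>f\<close> in
  \<open>(R/M)[x]\<close>, expressed without forming the residue field.\<close>

definition reduction_degree :: "'a poly \<Rightarrow> nat \<Rightarrow> bool"
  where "reduction_degree f i \<longleftrightarrow> f \<in> polys \<and> coeff f i \<notin> M \<and> (\<forall>k>i. coeff f k \<in> M)"

text \<open>Degrees add because \<open>R/M\<close> is a domain: modulo \<open>M\<close>, only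
  \<open>k = i\<close> contributes to the coefficient at \<open>i + j\<close>.\<close>

lemma reduction_degree_mult:
  assumes f: "reduction_degree f i" and g: "reduction_degree g j"
  shows "reduction_degree (f * g) (i + j)"
proof -
  have R: "coeff f k \<in> R" "coeff g k \<in> R" for k
    using f g by (auto simp: reduction_degree_def coeff_closed)
  have big: "coeff f k * coeff g l \<in> M" if "k > i \<or> l > j" for k l
    using that f g R by (auto simp: reduction_degree_def intro: M_mult M_mult')
  have "coeff (f * g) k \<in> M" if "k > i + j" for k
    unfolding coeff_mult using that by (intro M_sum big) auto
  moreover have "coeff (f * g) (i + j) \<notin> M"
  proof
    have "coeff (f * g) (i + j) = (\<Sum>k\<le>i+j. coeff f k * coeff g (i + j - k))"
      by (rule coeff_mult)
    also have "\<dots> = coeff f i * coeff g j + (\<Sum>k\<in>{..i+j} - {i}. coeff f k * coeff g (i + j - k))"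
      by (subst sum.remove[of _ i]) auto
    finally have "coeff f i * coeff g j
        = coeff (f * g) (i + j) - (\<Sum>k\<in>{..i+j} - {i}. coeff f k * coeff g (i + j - k))" by simp
    moreover have "(\<Sum>k\<in>{..i+j} - {i}. coeff f k * coeff g (i + j - k)) \<in> M"
    proof (intro M_sum big)
      fix k assume "k \<in> {..i + j} - {i}"
      then show "k > i \<or> i + j - k > j" by auto
    qed
    moreover assume "coeff (f * g) (i + j) \<in> M"
    ultimately have "coeff f i * coeff g j \<in> M" by (simp add: M_diff)
    then show False using M_prime R f g by (auto simp: reduction_degree_def)
  qed
  ultimately show ?thesis using f g by (simp add: reduction_degree_def polys_mult)
qed

lemma reduction_degree_power:
  assumes "reduction_degree f i" shows "reduction_degree (f ^ m) (m * i)"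
proof (induction m)
  case 0 show ?case by (simp add: reduction_degree_def polys_1 one_notin_M M_0)
next
  case (Suc m) then show ?case using reduction_degree_mult[OF assms Suc] by simp
qed

end

lemma pderiv_eq_const:
  fixes H :: "'a::field_char_0 poly"
  assumes "pderiv H = [:b:]"
  shows "H = [:poly H 0, b:]"
proof -
  have "pderiv (H - [:0, b:]) = 0" using assms by (simp add: pderiv_diff pderiv_pCons)
  then have "degree (H - [:0, b:]) = 0" by (simp add: pderiv_eq_0_iff)
  then obtain c where "H - [:0, b:] = [:c:]" by (rule degree_eq_zeroE)
  then have "H = [:c, b:]" by (simp add: algebra_simps)
  then show ?thesis by simp
qed

text \<open>If the reduction of \<open>f\<close> has degree \<open>i > 0\<close>, choose \<open>m\<close> with \<open>i m + 1 = p^s\<close>. Among the terms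
  \<open>a_k / (k + 1)\<close> of the integral of \<open>f^m = \<Sum> a_k x^k\<close>, only the one with \<open>k + 1 = p^s\<close> has a denominator
  of valuation \<open>s\<close> and a unit as numerator, so the integral cannot vanish.\<close>

lemma power_integrals_eq_0_imp_eq_0:
  fixes f :: "'a::field_char_0 poly"
  assumes ex: "\<And>m. m > 0 \<Longrightarrow> \<exists>H. pderiv H = f ^ m \<and> poly H 0 = 0 \<and> poly H 1 = 0"
  shows "f = 0"
proof (cases "degree f = 0")
  case True
  then obtain b where b: "f = [:b:]" by (rule degree_eq_zeroE)
  obtain H where H: "pderiv H = f ^ 1" "poly H 0 = 0" "poly H 1 = 0" using ex[of 1] by auto
  have "H = [:0, b:]" using pderiv_eq_const[of H b] H b by simp
  then show ?thesis using H b by simp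
next
  case False
  then have "degree f > 0" by simp
  then obtain p R e i where p: "prime p" "p > degree f" and R: "valuation_subring R"
    and pM: "of_nat p \<in> valuation_subring.M R"
    and "smult e f \<in> unital_subring.polys R" and i: "0 < i" "i \<le> degree f"
    and "coeff (smult e f) i \<notin> valuation_subring.M R"
      "\<And>k. k > i \<Longrightarrow> coeff (smult e f) k \<in> valuation_subring.M R"
    by (rule exists_nonconst_reduction) blast
  interpret valuation_subring R by fact
  define g where "g = smult e f"
  have g: "reduction_degree g i" unfolding reduction_degree_def g_def by (intro conjI allI impI) fact+
  have "\<not> p dvd i" using i p by (auto dest!: dvd_imp_le)
  then have "coprime p i" using p by (simp add: prime_imp_coprime)
  then obtain s where s: "s > 0" "i dvd p ^ s - 1" using i prime_gt_0_nat[OF p(1)] exists_dvd_power_minus_1 by blast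
  define Q where "Q = p ^ s"
  have "p \<ge> 2" using p by (simp add: prime_ge_2_nat)
  have Qp: "Q \<ge> p" unfolding Q_def using s \<open>p \<ge> 2\<close> by (intro self_le_power) auto
  obtain m where m: "Q - 1 = m * i" using s(2) unfolding Q_def by (metis dvdE mult.commute)
  have Qm: "Q = m * i + 1" using m Qp \<open>p \<ge> 2\<close> by simp
  have "m > 0" using Qm Qp \<open>p \<ge> 2\<close> by (cases m) auto
  then obtain H where H: "pderiv H = f ^ m" "poly H 0 = 0" "poly H 1 = 0" using ex by blast
  define G where "G = smult (e ^ m) H"
  have G: "pderiv G = g ^ m" "poly G 0 = 0" "poly G 1 = 0"
    by (simp_all add: G_def g_def H pderiv_smult smult_power)
  have gm: "reduction_degree (g ^ m) (m * i)" using g by (rule reduction_degree_power)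
  have coeff_G: "of_nat (Suc k) * coeff G (Suc k) = coeff (g ^ m) k" for k
    by (simp add: coeff_pderiv flip: G(1))
  \<comment> \<open>The bound \<open>degree G < p * Q\<close> keeps the \<open>p\<close>-adic
    valuation of every positive exponent in \<open>G\<close> at most \<open>s\<close>; it follows
    from \<open>degree f < p\<close> and \<open>i > 0\<close>.\<close>
  have "degree G \<le> Suc (degree (g ^ m))" by (simp add: degree_pderiv flip: G(1))
  also have "degree (g ^ m) \<le> degree f * m"
    using degree_power_le[of g m] degree_smult_le[of e f] mult_le_mono1 order.trans unfolding g_def by blast
  finally have "degree G \<le> Suc (degree f * m)" by simp
  also have "Suc (degree f * m) \<le> p * m + 1" using p(2) by (simp add: mult_le_mono1)
  also have "\<dots> < p * (m * i + 1)"
  proof -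
    have "p * m \<le> p * (m * i)" using i by simp
    moreover have "p * (m * i + 1) = p * (m * i) + p" by (simp add: distrib_left)
    ultimately show ?thesis using \<open>p \<ge> 2\<close> by linarith
  qed
  finally have degG: "degree G < p * Q" by (simp add: Qm)
  \<comment> \<open>The range is enlarged so that it contains \<open>Q\<close> whether or not
    \<open>Q\<close> is at most \<open>degree G\<close>.\<close>
  define S where "S = {..degree G + Q}"
  have "(\<Sum>k\<in>S. coeff G k) = (\<Sum>k\<le>degree G. coeff G k)"
    unfolding S_def by (rule sum.mono_neutral_right) (auto intro: coeff_eq_0)
  also have "\<dots> = 0" using G(3) by (simp add: poly_altdef)
  finally have "of_nat Q * (\<Sum>k\<in>S. coeff G k) = 0" by simp
  then have "(\<Sum>k\<in>S. of_nat Q * coeff G k) = 0" by (simp add: sum_distrib_left)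
  then have "of_nat Q * coeff G Q + (\<Sum>k\<in>S - {Q}. of_nat Q * coeff G k) = 0"
    by (subst (asm) sum.remove[of _ Q]) (auto simp: S_def)
  then have "of_nat Q * coeff G Q = - (\<Sum>k\<in>S - {Q}. of_nat Q * coeff G k)"
    by (simp add: eq_neg_iff_add_eq_0)
  \<comment> \<open>Write \<open>k = p^v n\<close> with \<open>n\<close> prime to \<open>p\<close>.
    Either \<open>v < s\<close> and a factor \<open>p\<close> survives, or \<open>v = s\<close> and
    \<open>k > Q\<close>, so that \<open>coeff (g ^ m) (k - 1)\<close> lies beyond the reduced
    degree.\<close>
  moreover have "of_nat Q * coeff G k \<in> M" if "k \<noteq> Q" for k
  proof (cases "k = 0 \<or> k > degree G")
    case True
    then have "coeff G k = 0" using G(2) by (auto simp: coeff_eq_0 poly_0_coeff_0)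
    then show ?thesis by (simp only: mult_zero_right M_0)
  next
    case False
    then have k: "k > 0" "k < p * Q" using degG by auto
    obtain n where "k = p ^ multiplicity p k * n" "\<not> p dvd n"
      using multiplicity_decompose'[of k p] k(1) not_prime_unit[of p] p(1) by blast
    then obtain v where n: "k = p ^ v * n" "\<not> p dvd n" by blast
    have "n > 0" using n k by (cases n) auto
    have "p ^ v \<le> k" using n(1) \<open>n > 0\<close> by simp
    also have "k < p ^ Suc s" using k(2) by (simp add: Q_def)
    finally have "p ^ v < p ^ Suc s" .
    then have "v \<le> s" using \<open>p \<ge> 2\<close> by (subst (asm) power_strict_increasing_iff) auto
    have inv: "inverse (of_nat n) \<in> R" using p(1) pM n(2) by (rule inverse_of_nat_closed)
    have "of_nat Q * coeff G k = of_nat p ^ (s - v) * (of_nat p ^ v * coeff G k)"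
      using \<open>v \<le> s\<close> by (simp add: Q_def flip: power_add mult.assoc)
    also have "of_nat p ^ v * coeff G k = (of_nat k * coeff G k) * inverse (of_nat n)"
      using \<open>n > 0\<close> by (simp add: n(1))
    also have "of_nat k * coeff G k = coeff (g ^ m) (k - 1)" using coeff_G[of "k - 1"] k by simp
    finally have eq: "of_nat Q * coeff G k = of_nat p ^ (s - v) * (coeff (g ^ m) (k - 1) * inverse (of_nat n))" .
    have cR: "coeff (g ^ m) (k - 1) \<in> R" using gm by (simp add: reduction_degree_def coeff_closed)
    show ?thesis
    proof (cases "v = s")
      case False
      then obtain t where t: "s - v = Suc t" using \<open>v \<le> s\<close> by (metis Suc_diff_Suc le_neq_implies_less)
      have "of_nat p ^ (s - v) \<in> M" unfolding t power_Suc using pM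
        by (intro M_mult power_closed of_nat_closed)
      then show ?thesis unfolding eq using cR inv by (intro M_mult mult_closed)
    next
      case True
      then have "n \<noteq> 1" using n(1) \<open>k \<noteq> Q\<close> by (auto simp: Q_def)
      then have "k > Q" using n(1) \<open>n > 0\<close> True \<open>k \<noteq> Q\<close> by (cases "k \<ge> Q") (auto simp: Q_def)
      then have "k - 1 > m * i" by (simp add: Qm)
      then have "coeff (g ^ m) (k - 1) \<in> M" using gm by (simp add: reduction_degree_def)
      then show ?thesis unfolding eq using inv by (intro M_mult' power_closed of_nat_closed M_mult)
    qed
  qed
  ultimately have "of_nat Q * coeff G Q \<in> M" by (auto intro!: M_uminus M_sum)
  then have "coeff (g ^ m) (m * i) \<in> M" using coeff_G[of "m * i"] by (simp add: Qm)
  then show ?thesis using gm by (simp add: reduction_degree_def)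
qed

section \<open>Differences of polynomials\<close>

primrec falling_poly :: "nat \<Rightarrow> 'a::comm_ring_1 poly"
  where "falling_poly 0 = 1"
  | "falling_poly (Suc n) = falling_poly n * [:- of_nat n, 1:]"

text \<open>Shifting turns \<open>x (x - 1) ... (x - n)\<close> into
  \<open>(x + 1) x ... (x - n + 1)\<close>: a factor is gained at the front and the last one is
  lost.\<close>

lemma falling_poly_shift: "pcompose (falling_poly (Suc n)) [:1, 1:] = [:1, 1:] * falling_poly n"
proof (induction n)
  case 0 show ?case by (simp add: pcompose_pCons)
next
  case (Suc n)
  have "pcompose (falling_poly (Suc (Suc n))) [:1, 1:]
      = pcompose (falling_poly (Suc n)) [:1, 1:] * ([:- of_nat n, 1:] :: 'a poly)"
    by (subst falling_poly.simps, subst pcompose_mult) (simp add: pcompose_pCons)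
  then show ?case unfolding Suc by (simp only: falling_poly.simps mult.assoc)
qed

text \<open>Falling factorials play the part of monomials for the difference operator: both terms
  share the factor \<open>falling_poly n\<close>, and the remaining linear factors differ by
  \<open>n + 1\<close>.\<close>

lemma falling_poly_difference:
  "pcompose (falling_poly (Suc n)) [:1, 1:] - falling_poly (Suc n) = smult (of_nat (Suc n)) (falling_poly n)"
proof -
  have "pcompose (falling_poly (Suc n)) [:1, 1:] - falling_poly (Suc n)
      = falling_poly n * ([:1, 1:] - [:- of_nat n, 1:] :: 'a poly)"
    unfolding falling_poly_shift by (simp only: falling_poly.simps right_diff_distrib mult.commute)
  also have "[:1, 1:] - [:- of_nat n, 1:] = ([:of_nat (Suc n):] :: 'a poly)" by simp
  finally show ?thesis by simp
qed

lemma poly_falling_poly: "poly (falling_poly n) (of_nat x) = of_nat (fact n * (x choose n))"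
proof (induction n)
  case 0 show ?case by simp
next
  case (Suc n)
  have "(x choose n) * (x - n) = Suc n * (x choose Suc n)"
    using binomial_absorb_comp[of x n] binomial_absorption[of n x]
    by (cases x) (auto simp: mult.commute simp del: binomial_Suc_Suc intro: Suc_times_binomial_eq)
  then have eq: "fact n * (x choose n) * (x - n) = fact (Suc n) * (x choose Suc n)"
    by (simp only: mult.assoc fact_Suc of_nat_id) (simp only: mult.left_commute)
  have "poly (falling_poly (Suc n)) (of_nat x) = of_nat (fact n * (x choose n)) * (of_nat x - of_nat n :: 'a)"
    by (simp add: Suc algebra_simps)
  also have "\<dots> = of_nat (fact n * (x choose n) * (x - n))"
  \<comment> \<open>For \<open>n > x\<close> the truncated \<open>x - n\<close> differs from the
    difference in the ring, but then \<open>x choose n\<close> is 0.\<close>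
  proof (cases "n \<le> x")
    case True then show ?thesis by (simp only: of_nat_mult of_nat_diff)
  qed (simp add: binomial_eq_0)
  finally show ?case unfolding eq .
qed

text \<open>The derivative at the root 0 is the product of the remaining factors
  \<open>-1, ..., -n\<close>.\<close>

lemma pderiv_falling_poly_0: "poly (pderiv (falling_poly (Suc n))) 0 = (- 1) ^ n * of_nat (fact n)"
proof (induction n)
  case 0 show ?case by (simp add: pderiv_pCons)
next
  case (Suc n)
  have "poly (pderiv (falling_poly (Suc (Suc n)))) 0
     = poly (pderiv (falling_poly (Suc n)) * [:- of_nat (Suc n), 1:] + falling_poly (Suc n) * 1) (0 :: 'a)"
    by (simp only: falling_poly.simps(2)[of "Suc n"] pderiv_mult) (simp add: pderiv_pCons)
  also have "\<dots> = - of_nat (Suc n) * poly (pderiv (falling_poly (Suc n))) 0"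
    using poly_falling_poly[of "Suc n" 0, where 'a='a] by (simp del: falling_poly.simps)
  finally show ?case unfolding Suc by (simp add: algebra_simps)
qed

text \<open>Every polynomial over \<open>R\<close> is an \<open>R\<close>-combination of the falling factorials. The induction
  over the coefficients goes through after multiplying by \<open>falling_poly j\<close>, because
  \<open>x * falling_poly j = falling_poly (j + 1) + j * falling_poly j\<close>.\<close>

lemma (in unital_subring) falling_poly_induct [consumes 1, case_names falling add smult]:
  assumes f: "f \<in> polys"
    and falling: "\<And>n. P (falling_poly n)"
    and add: "\<And>f g. P f \<Longrightarrow> P g \<Longrightarrow> P (f + g)"
    and smult: "\<And>c f. c \<in> R \<Longrightarrow> P f \<Longrightarrow> P (smult c f)"
  shows "P f"
proof -
  have "P (f * falling_poly n)" for n
    using f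
  proof (induction f arbitrary: n rule: pCons_induct)
    case 0
    show ?case using smult[OF zero_closed falling[of n]] by simp
  next
    case (pCons a f)
    have f: "a \<in> R" "f \<in> polys" using pCons.prems by (auto simp: polys_pCons)
    have "pCons a f * falling_poly n = smult a (falling_poly n) + f * ([:0, 1:] * falling_poly n)"
      by (simp add: mult_pCons_left algebra_simps)
    also have "[:0, 1:] * falling_poly n = falling_poly (Suc n) + smult (of_nat n) (falling_poly n)"
      by (simp add: algebra_simps)
    finally have eq: "pCons a f * falling_poly n = smult a (falling_poly n)
        + (f * falling_poly (Suc n) + smult (of_nat n) (f * falling_poly n))"
      by (simp only: distrib_left mult_smult_right)
    show ?case unfolding eq using f
      by (intro add smult falling pCons.IH of_nat_closed)
  qed
  from this[of 0] show ?thesis by simp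
qed

lemma unital_subring_UNIV: "unital_subring UNIV"
  by unfold_locales auto

text \<open>On falling factorials a preimage is \<open>falling_poly (n + 1) / (n + 1)\<close>; the
  induction rule, taken over the whole field, extends this linearly.\<close>

lemma exists_difference_preimage:
  fixes f :: "'a::field_char_0 poly"
  shows "\<exists>H. pcompose H [:1, 1:] - H = f"
proof -
  interpret unital_subring "UNIV :: 'a set" by (rule unital_subring_UNIV)
  have "f \<in> polys" by (simp add: polys_def)
  then show ?thesis
  proof (induction rule: falling_poly_induct)
    case (falling n)
    have "pcompose (smult (inverse (of_nat (Suc n))) (falling_poly (Suc n))) [:1, 1:]
        - smult (inverse (of_nat (Suc n))) (falling_poly (Suc n)) = (falling_poly n :: 'a poly)"
      by (simp only: pcompose_smult falling_poly_difference flip: smult_diff_right) (simp del: of_nat_Suc)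
    then show ?case by blast
  next
    case (add f g)
    then obtain F G where "pcompose F [:1, 1:] - F = f" "pcompose G [:1, 1:] - G = g" by blast
    then have "pcompose (F + G) [:1, 1:] - (F + G) = f + g" by (auto simp: pcompose_add)
    then show ?case by blast
  next
    case (smult c f)
    then obtain F where "pcompose F [:1, 1:] - F = f" by blast
    then have "pcompose (smult c F) [:1, 1:] - smult c F = smult c f"
      by (auto simp: pcompose_smult smult_diff_right)
    then show ?case by blast
  qed
qed

text \<open>\<open>G\<close> takes the value \<open>G(0)\<close> at all naturals, which are
  infinitely many points in characteristic 0. Hence \<open>H(x + 1) - H(x)\<close> determines the
  derivative of \<open>H\<close>.\<close>

lemma pderiv_eq_0_if_periodic:
  fixes G :: "'a::field_char_0 poly"
  assumes "pcompose G [:1, 1:] = G"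
  shows "pderiv G = 0"
proof -
  have step: "poly G (x + 1) = poly G x" for x
    using arg_cong[OF assms, of "\<lambda>G. poly G x"] by (simp add: poly_pcompose add.commute)
  have "poly G (of_nat n) = poly G 0" for n
  proof (induction n)
    case (Suc n) then show ?case using step[of "of_nat n"] by (simp add: add.commute)
  qed simp
  then have "range of_nat \<subseteq> {x. poly (G - [:poly G 0:]) x = 0}" by auto
  moreover have "infinite (range (of_nat :: nat \<Rightarrow> 'a))" by (simp add: finite_image_iff inj_on_def)
  ultimately have "G - [:poly G 0:] = 0" using poly_roots_finite finite_subset by blast
  then have "G = [:poly G 0:]" by simp
  then have "degree G = 0" by (metis degree_pCons_0)
  then show ?thesis by (simp add: pderiv_eq_0_iff)
qed

section \<open>Power sums and roots in the residue field\<close>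

context valuation_subring
begin

lemma poly_diff_in_M:
  assumes "h \<in> polys" "x \<in> R" "y \<in> R" "x - y \<in> M"
  shows "poly h x - poly h y \<in> M"
  using assms(1)
proof (induction h rule: pCons_induct)
  case 0 show ?case by (simp add: M_0)
next
  case (pCons a h)
  then have h: "h \<in> polys" by (simp add: polys_pCons)
  have "(x - y) * poly h x + y * (poly h x - poly h y) \<in> M"
    using assms pCons h by (intro M_add M_mult M_mult' poly_closed) auto
  then show ?case by (simp add: algebra_simps)
qed

text \<open>In the residue field, \<open>h(y 0) + ... + h(y (p - 1)) = 0\<close> for every
  \<open>h\<close> with \<open>h(0) = 0\<close>. With \<open>h\<close> separating a nonzero value
  \<open>y a\<close> from the other values, the multiplicity of \<open>y a\<close> is 0 modulo
  \<open>p\<close>, hence equal to \<open>p\<close>.\<close>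

lemma power_sums_in_M_imp_constant:
  assumes p: "prime p" "of_nat p \<in> M"
    and y: "\<And>i. i < p \<Longrightarrow> y i \<in> R"
    and sums: "\<And>m. m > 0 \<Longrightarrow> (\<Sum>i<p. y i ^ m) \<in> M"
    and "i < p" "j < p"
  shows "y i - y j \<in> M"
proof (cases "\<forall>i<p. y i \<in> M")
  case True then show ?thesis using assms(5,6) by (auto intro: M_diff)
next
  case False
  then obtain a where a: "a < p" "y a \<notin> M" by blast
  define E where "E = {i. i < p \<and> y i - y a \<in> M}"
  define N where "N = {i. i < p \<and> y i - y a \<notin> M}"
  have fin: "finite E" "finite N" "E \<inter> N = {}" "E \<union> N = {..<p}" by (auto simp: E_def N_def)
  \<comment> \<open>The factor \<open>x\<close> gives \<open>h(0) = 0\<close>, so that only power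
    sums of positive exponent enter; the product kills the values indexed by
    \<open>N\<close>.\<close>
  define h where "h = [:0, 1:] * (\<Prod>i\<in>N. [:- y i, 1:])"
  have "(\<Prod>i\<in>N. [:- y i, 1:]) \<in> polys"
    by (rule polys_prod) (auto simp: N_def polys_0 polys_pCons one_closed y intro: uminus_closed)
  then have h: "h \<in> polys" unfolding h_def
    by (intro polys_mult) (auto simp: polys_pCons polys_0 zero_closed one_closed)
  have "poly h 0 = 0" by (simp add: h_def)
  have "(\<Sum>i<p. poly h (y i)) = (\<Sum>k\<le>degree h. coeff h k * (\<Sum>i<p. y i ^ k))"
    unfolding poly_altdef by (subst sum.swap) (simp add: sum_distrib_left)
  also have "\<dots> \<in> M"
  proof (rule M_sum)
    fix k
    show "coeff h k * (\<Sum>i<p. y i ^ k) \<in> M"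
    proof (cases "k = 0")
      case True then show ?thesis using \<open>poly h 0 = 0\<close> by (simp add: poly_0_coeff_0 M_0)
    next
      case False then show ?thesis using h sums by (intro M_mult' coeff_closed) auto
    qed
  qed
  finally have "(\<Sum>i<p. poly h (y i)) \<in> M" .
  moreover have "(\<Sum>i<p. poly h (y i)) = (\<Sum>i\<in>E. poly h (y i)) + (\<Sum>i\<in>N. poly h (y i))"
    using fin by (subst fin(4)[symmetric], subst sum.union_disjoint) auto
  moreover have "(\<Sum>i\<in>N. poly h (y i)) = 0"
    using fin by (intro sum.neutral) (auto simp: h_def poly_prod)
  moreover have "(\<Sum>i\<in>E. poly h (y a) - poly h (y i)) \<in> M"
  proof (rule M_sum)
    fix i assume i: "i \<in> E"
    then have "y a - y i \<in> M" using M_uminus[of "y i - y a"] by (simp add: E_def)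
    then show "poly h (y a) - poly h (y i) \<in> M"
      using h i a y by (intro poly_diff_in_M) (auto simp: E_def)
  qed
  ultimately have "(\<Sum>i\<in>E. poly h (y i)) + (\<Sum>i\<in>E. poly h (y a) - poly h (y i)) \<in> M"
    by (intro M_add) auto
  then have "of_nat (card E) * poly h (y a) \<in> M" by (simp add: sum_subtractf)
  moreover have "poly h (y a) \<notin> M"
  proof
    assume "poly h (y a) \<in> M"
    then have "y a * (\<Prod>i\<in>N. y a - y i) \<in> M" by (simp add: h_def poly_prod)
    moreover have "(\<Prod>i\<in>N. y a - y i) \<in> R"
      using a y by (intro prod_closed) (auto simp: N_def intro!: diff_closed)
    ultimately have "(\<Prod>i\<in>N. y a - y i) \<in> M" using M_prime a y by blast
    then obtain i where "i \<in> N" "y a - y i \<in> M"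
      using fin a y M_prod[of N "\<lambda>i. y a - y i"] by (auto simp: N_def intro!: diff_closed)
    then show False using M_uminus[of "y a - y i"] by (simp add: N_def)
  qed
  ultimately have "of_nat (card E) \<in> M" using M_prime poly_closed[OF h y[OF a(1)]] of_nat_closed by blast
  then have "p dvd card E" using of_nat_notin_M[OF p] by blast
  moreover have "a \<in> E" using a by (simp add: E_def M_0)
  then have "card E > 0" using fin by (auto simp: card_gt_0_iff)
  ultimately have "p \<le> card E" by (rule dvd_imp_le)
  then have "E = {..<p}" using fin by (intro card_seteq) auto
  then have "y i - y a \<in> M" "y j - y a \<in> M" using assms(5,6) by (auto simp: E_def)
  then have "(y i - y a) - (y j - y a) \<in> M" by (rule M_diff)
  then show ?thesis by simp
qed

lemma synthetic_div_closed:
  "f \<in> polys \<Longrightarrow> c \<in> R \<Longrightarrow> synthetic_div f c \<in> polys"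
proof (induction f rule: pCons_induct)
  case 0 then show ?case by (simp add: polys_0)
next
  case (pCons a f)
  then show ?case by (simp add: polys_pCons poly_closed)
qed

text \<open>The bound on the number of roots over the residue field, lifted to \<open>R\<close>.
  Synthetic division at a root leaves a remainder in \<open>M\<close>, and differences of roots are
  units.\<close>

lemma coeffs_in_M_if_many_roots:
  assumes "f \<in> polys" "degree f \<le> n"
    and "\<And>i. i \<le> n \<Longrightarrow> x i \<in> R" "\<And>i. i \<le> n \<Longrightarrow> poly f (x i) \<in> M"
    and "\<And>i j. i < j \<Longrightarrow> j \<le> n \<Longrightarrow> x j - x i \<notin> M"
  shows "coeff f k \<in> M"
  using assms
proof (induction n arbitrary: f k)
  case 0
  then obtain b where b: "f = [:b:]" using degree_eq_zeroE[of f] by auto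
  then show ?case using "0.prems"(4)[of 0] by (cases k) (auto simp: M_0)
next
  case (Suc n)
  define c where "c = x (Suc n)"
  have c: "c \<in> R" "poly f c \<in> M" using Suc.prems(3,4) by (auto simp: c_def)
  define q where "q = synthetic_div f c"
  have f: "f = [:- c, 1:] * q + [:poly f c:]"
    unfolding q_def by (rule synthetic_div_correct'[symmetric])
  have q: "q \<in> polys" unfolding q_def using Suc.prems(1) c by (intro synthetic_div_closed)
  have qM: "coeff q k \<in> M" for k
  proof (rule Suc.IH)
    show "degree q \<le> n" using Suc.prems(2) by (simp add: q_def degree_synthetic_div)
    show "poly q (x i) \<in> M" if "i \<le> n" for i
    proof -
      have xi: "x i \<in> R" using Suc.prems(3) that by simp
      have "poly f (x i) = (x i - c) * poly q (x i) + poly f c"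
        using arg_cong[OF f, of "\<lambda>f. poly f (x i)"] by (simp add: algebra_simps)
      then have "(c - x i) * poly q (x i) = poly f c - poly f (x i)" by (simp add: algebra_simps)
      moreover have "poly f c - poly f (x i) \<in> M" using c Suc.prems(4)[of i] that by (intro M_diff) auto
      ultimately have "(c - x i) * poly q (x i) \<in> M" by simp
      moreover have "c - x i \<notin> M" using Suc.prems(5)[of i "Suc n"] that by (simp add: c_def)
      ultimately show ?thesis using M_prime c xi q by (metis diff_closed poly_closed)
    qed
  qed (use q Suc.prems in auto)
  have "coeff ([:- c, 1:] * q + [:poly f c:]) k \<in> M"
    using qM c by (cases k) (auto intro!: M_add M_diff M_mult' M_uminus uminus_closed simp: coeff_pCons)
  then show ?case by (simp only: f[symmetric])
qed

end

section \<open>A congruence of von Staudt-Clausen type\<close>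

text \<open>If \<open>p\<close> does not divide \<open>n + 1\<close>, the denominator is a unit and
  the factor \<open>p\<close> suffices. If \<open>n + 1 = p l\<close> with \<open>l >= 2\<close>,
  then \<open>p l\<close> divides \<open>p! l!\<close>, which divides \<open>n!\<close> since
  \<open>p + l <= n\<close>.\<close>

lemma (in valuation_subring) fact_div_Suc_in_M:
  assumes p: "prime p" "of_nat p \<in> M" "p > 2" and "Suc n \<noteq> p"
  shows "of_nat p * of_nat (fact n) * inverse (of_nat (Suc n)) \<in> M"
proof (cases "p dvd Suc n")
  case False
  then have "inverse (of_nat (Suc n)) \<in> R" using p(1,2) by (intro inverse_of_nat_closed)
  then show ?thesis using p(2) by (intro M_mult of_nat_closed)
next
  case True
  then obtain l where l: "Suc n = p * l" by blast
  then have "l \<noteq> 0" "l \<noteq> 1" using assms(4) by (auto intro: ccontr)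
  then have "l \<ge> 2" by linarith
  obtain u v where uv: "p = u + 3" "l = v + 2" using p(3) \<open>l \<ge> 2\<close>
    by (metis add.commute le_Suc_ex less_eq_Suc_le numeral_3_eq_3 numeral_2_eq_2)
  \<comment> \<open>Equivalent to \<open>(p - 1) (l - 1) >= 2\<close>, which is where
    \<open>p > 2\<close> enters.\<close>
  have "p + l \<le> n" using l by (simp add: uv algebra_simps)
  then have "fact p * fact l dvd (fact n :: nat)"
    using fact_fact_dvd_fact[of p l] fact_dvd dvd_trans by blast
  moreover have "p dvd fact p" "l dvd fact l"
    using p(3) \<open>l \<ge> 2\<close> by (simp_all add: dvd_fact)
  then have "p * l dvd fact p * fact l" by (rule mult_dvd_mono)
  ultimately have "p * l dvd fact n" using dvd_trans by blast
  then obtain c where c: "fact n = p * l * c" by blast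
  have "(of_nat (fact n) :: 'a) * inverse (of_nat (Suc n)) = of_nat c * (of_nat (Suc n) * inverse (of_nat (Suc n)))"
    unfolding c l by (simp add: mult_ac)
  also have "\<dots> \<in> R"
    by (cases "of_nat (Suc n) = (0 :: 'a)") (simp_all only: zero_closed of_nat_closed right_inverse mult_1_right inverse_zero mult_zero_right not_False_eq_True)
  finally show ?thesis using p(2) by (simp only: mult.assoc M_mult)
qed


text \<open>Modulo \<open>M\<close>, the functional \<open>f \<mapsto> p H'(0)\<close>, where \<open>H(x + 1) - H(x) = f\<close>, is \<open>f \<mapsto> f(0) + \<dots> + f(p - 1)\<close>;
  on monomials this is the von Staudt--Clausen congruence for Bernoulli numbers.\<close>

lemma (in valuation_subring) difference_preimage_pderiv_cong:
  assumes p: "prime p" "of_nat p \<in> M" "p > 2" and f: "f \<in> polys"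
    and char0: "\<And>n. of_nat (Suc n) \<noteq> (0::'a)"
  shows "\<exists>H. pcompose H [:1, 1:] - H = f \<and> of_nat p * poly (pderiv H) 0 - (\<Sum>i<p. poly f (of_nat i)) \<in> M"
  using f
proof (induction rule: falling_poly_induct)
  case (falling n)
  define H where "H = smult (inverse (of_nat (Suc n))) (falling_poly (Suc n) :: 'a poly)"
  have "pcompose H [:1, 1:] - H = falling_poly n"
    unfolding H_def
    by (simp only: pcompose_smult falling_poly_difference smult_smult char0 flip: smult_diff_right)
      (simp only: left_inverse char0 smult_1_left not_False_eq_True)
  moreover have "of_nat p * poly (pderiv H) 0 - (\<Sum>i<p. poly (falling_poly n) (of_nat i)) \<in> M"
  proof -
    \<comment> \<open>The hockey-stick identity.\<close>
    have "(\<Sum>i<p. i choose n) = p choose Suc n"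
      using sum_choose_upper[of n "p - 1"] p(3) by (simp add: lessThan_Suc_atMost[symmetric] del: binomial_Suc_Suc)
    then have sum: "(\<Sum>i<p. poly (falling_poly n) (of_nat i)) = (of_nat (fact n * (p choose Suc n)) :: 'a)"
      unfolding poly_falling_poly of_nat_sum[symmetric] sum_distrib_left[symmetric] by simp
    have H': "of_nat p * poly (pderiv H) 0
        = (- 1) ^ n * (of_nat p * of_nat (fact n) * inverse (of_nat (Suc n)) :: 'a)"
      by (simp add: H_def pderiv_smult pderiv_falling_poly_0 mult_ac del: falling_poly.simps of_nat_Suc)
    show ?thesis
    \<comment> \<open>For \<open>n + 1 = p\<close> both quantities equal \<open>n!\<close>, as
      \<open>n\<close> is even; otherwise each of them lies in \<open>M\<close>.\<close>
    proof (cases "Suc n = p")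
      case True
      then have "even n" using p(1,3) prime_odd_nat[of p] by auto
      have "(of_nat p * of_nat (fact n) * inverse (of_nat p) :: 'a)
          = of_nat (fact n) * (of_nat p * inverse (of_nat p))"
        by (simp only: mult_ac)
      also have "(of_nat p * inverse (of_nat p) :: 'a) = 1"
        using char0[of n] unfolding True by (rule right_inverse)
      finally have "(of_nat p * of_nat (fact n) * inverse (of_nat p) :: 'a) = of_nat (fact n)" by (simp only: mult_1_right)
      then show ?thesis unfolding H' sum True using \<open>even n\<close> by (simp only: power_minus_even binomial_n_n power_one mult_1_left mult_1_right diff_self M_0)
    next
      case False
      have "of_nat (fact n * (p choose Suc n)) \<in> M"
      proof (cases "Suc n < p")
        case True
        then have "p dvd (p choose Suc n)" using p(1) by (intro dvd_choose_prime) auto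
        then obtain c where c: "p choose Suc n = p * c" by blast
        show ?thesis unfolding c of_nat_mult using p(2) by (intro M_mult' M_mult of_nat_closed)
      next
        case F: False
        then have "p choose Suc n = 0" using False by (intro binomial_eq_0) simp
        then show ?thesis by (simp only: mult_zero_right of_nat_0 M_0)
      qed
      moreover have "(- 1) ^ n * (of_nat p * of_nat (fact n) * inverse (of_nat (Suc n))) \<in> M"
        using fact_div_Suc_in_M[OF p False] by (rule M_mult'[rotated]) (intro power_closed uminus_closed one_closed)
      ultimately show ?thesis unfolding H' sum by (intro M_diff)
    qed
  qed
  ultimately show ?case by blast
next
  case (add f g)
  then obtain F G where F: "pcompose F [:1, 1:] - F = f" "of_nat p * poly (pderiv F) 0 - (\<Sum>i<p. poly f (of_nat i)) \<in> M"
    and G: "pcompose G [:1, 1:] - G = g" "of_nat p * poly (pderiv G) 0 - (\<Sum>i<p. poly g (of_nat i)) \<in> M" by blast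
  have "pcompose (F + G) [:1, 1:] - (F + G) = f + g" using F(1) G(1) by (auto simp: pcompose_add)
  moreover have "of_nat p * poly (pderiv (F + G)) 0 - (\<Sum>i<p. poly (f + g) (of_nat i)) \<in> M"
    using M_add[OF F(2) G(2)] by (simp add: pderiv_add sum.distrib algebra_simps)
  ultimately show ?case by blast
next
  case (smult c f)
  then obtain F where F: "pcompose F [:1, 1:] - F = f" "of_nat p * poly (pderiv F) 0 - (\<Sum>i<p. poly f (of_nat i)) \<in> M"
    by blast
  have "pcompose (smult c F) [:1, 1:] - smult c F = smult c f"
    using F(1) by (auto simp: pcompose_smult smult_diff_right)
  moreover have "of_nat p * poly (pderiv (smult c F)) 0 - (\<Sum>i<p. poly (smult c f) (of_nat i)) \<in> M"
    using M_mult'[OF smult(1) F(2)] by (simp add: pderiv_smult sum_distrib_left algebra_simps)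
  ultimately show ?case by blast
qed

text \<open>For non-constant \<open>f\<close>, let \<open>g = e f\<close> have coefficients in
  \<open>R\<close>, a non-constant reduction and degree less than \<open>p\<close>. The congruence
  makes the power sums of \<open>g(0), ..., g(p - 1)\<close> vanish modulo \<open>M\<close>, so
  \<open>g - g(0)\<close> has \<open>p\<close> roots there, more than its degree.\<close>

lemma power_differences_eq_0_imp_eq_0:
  fixes f :: "'a::field_char_0 poly"
  assumes ex: "\<And>m. m > 0 \<Longrightarrow> \<exists>H. pcompose H [:1, 1:] - H = f ^ m \<and> poly (pderiv H) 0 = 0"
  shows "f = 0"
proof -
  \<comment> \<open>The congruence comes with its own preimage. Two preimages have a periodic
    difference, so all of them have derivative 0 at 0.\<close>
  have unique: "poly (pderiv G) 0 = 0"
    if "m > 0" "pcompose G [:1, 1:] - G = smult c (f ^ m)" for m c G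
  proof -
    obtain H where H: "pcompose H [:1, 1:] - H = f ^ m" "poly (pderiv H) 0 = 0" using ex \<open>m > 0\<close> by blast
    have "pcompose (G - smult c H) [:1, 1:] - (G - smult c H) = 0"
      using that(2) H(1)
      by (simp add: pcompose_diff pcompose_smult algebra_simps flip: smult_diff_right)
        (metis (no_types, opaque_lifting) add.commute diff_add_cancel smult_add_right)
    then have "pderiv (G - smult c H) = 0" by (intro pderiv_eq_0_if_periodic) simp
    then show ?thesis using H(2) by (simp add: pderiv_diff pderiv_smult)
  qed
  show ?thesis
  proof (cases "degree f = 0")
    case True
    then obtain b where b: "f = [:b:]" by (rule degree_eq_zeroE)
    have "poly (pderiv [:0, b:]) 0 = 0"
      using unique[of 1 "[:0, b:]" 1] by (simp add: b pcompose_pCons)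
    then show ?thesis by (simp add: b pderiv_pCons)
  next
    case False
    then have "degree f > 0" by simp
    then obtain p R e i where p: "prime p" "p > max 2 (degree f)" and R: "valuation_subring R"
      and pM: "of_nat p \<in> valuation_subring.M R"
      and g: "smult e f \<in> unital_subring.polys R" and i: "0 < i" "i \<le> degree f"
      and gi: "coeff (smult e f) i \<notin> valuation_subring.M R"
      by (rule exists_nonconst_reduction) blast
    interpret valuation_subring R by fact
    define g where "g = smult e f"
    have gR: "g \<in> polys" using g by (simp add: g_def)
    have "(\<Sum>i<p. poly g (of_nat i) ^ m) \<in> M" if "m > 0" for m
    proof -
      have "p > 2" using p by simp
      then obtain H where H: "pcompose H [:1, 1:] - H = g ^ m"
        "of_nat p * poly (pderiv H) 0 - (\<Sum>i<p. poly (g ^ m) (of_nat i)) \<in> M"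
        using difference_preimage_pderiv_cong[OF p(1) pM _ polys_power[OF gR]] of_nat_neq_0 by blast
      have "poly (pderiv H) 0 = 0"
        using unique[OF that, of H "e ^ m"] H(1) by (simp add: g_def smult_power)
      then have "- (\<Sum>i<p. poly g (of_nat i) ^ m) \<in> M" using H(2) by (simp add: poly_power)
      then show ?thesis using M_uminus by fastforce
    qed
    then have const: "poly g (of_nat i) - poly g (of_nat 0) \<in> M" if "i < p" for i
      using that p by (intro power_sums_in_M_imp_constant[OF p(1) pM, where y="\<lambda>i. poly g (of_nat i)"])
        (auto intro: poly_closed gR of_nat_closed)
    have "coeff (g - [:poly g 0:]) i \<in> M"
    proof (rule coeffs_in_M_if_many_roots[where n="p - 1" and x=of_nat])
      show "g - [:poly g 0:] \<in> polys"
        using gR by (intro polys_diff) (auto simp: polys_pCons polys_0 intro: poly_closed zero_closed)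
      have "degree g \<le> p - 1" unfolding g_def using p degree_smult_le[of e f] by linarith
      then show "degree (g - [:poly g 0:]) \<le> p - 1"
        by (intro degree_diff_le) auto
      show "of_nat i \<in> R" for i by (rule of_nat_closed)
      show "poly (g - [:poly g 0:]) (of_nat i) \<in> M" if "i \<le> p - 1" for i
        using const[of i] that prime_gt_0_nat[OF p(1)] by simp
      show "of_nat j - of_nat i \<notin> M" if "i < j" "j \<le> p - 1" for i j
      proof -
        have "\<not> p dvd j - i" using that p(2) by (auto dest!: dvd_imp_le)
        then show ?thesis using of_nat_notin_M[OF p(1) pM, of "j - i"] that by (simp add: of_nat_diff)
      qed
    qed
    moreover have "coeff (g - [:poly g 0:]) i = coeff g i" using i by (cases i) auto
    ultimately show ?thesis using gi by (simp add: g_def)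
  qed
qed

section \<open>Substitution of a polynomial of degree at least two\<close>

context
  fixes q :: "'a::field poly"
  assumes q: "degree q \<ge> 2"
begin

lemma pcompose_inj:
  assumes "pcompose f q = pcompose g q" shows "f = g"
proof -
  have "pcompose (f - g) q = 0" using assms by (simp add: pcompose_diff)
  then show ?thesis using pcompose_eq_0[of "f - g" q] q by simp
qed

text \<open>The hypothesis reads \<open>2 g g(q) = g\<^sup>2 - h + T(q)\<close> with \<open>T = g\<^sup>2 + h\<close>. For \<open>T = r g + s\<close> with \<open>deg s < deg g\<close>
  this becomes \<open>(2 g - r(q)) g(q) = g\<^sup>2 - h + s(q)\<close>. The right side has degree at most \<open>2 deg g\<close> or less than
  \<open>deg g(q)\<close>, hence at most \<open>deg g(q)\<close> because \<open>deg q \<ge> 2\<close>, and so \<open>2 g - r(q)\<close> is constant.\<close>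

lemma pcompose_preimage_if_square:
  assumes two: "(2::'a) \<noteq> 0" and "degree g > 0"
    and eq: "(g - pcompose g q)\<^sup>2 = h - pcompose h q"
  obtains g1 where "g = pcompose g1 q"
proof -
  define d where "d = degree q"
  have d: "d \<ge> 2" using q by (simp add: d_def)
  define e where "e = degree g"
  have e: "e > 0" using assms(2) by (simp add: e_def)
  have deg_comp: "degree (pcompose f q) = degree f * d" for f :: "'a poly"
    by (simp add: degree_pcompose d_def)
  \<comment> \<open>Otherwise \<open>h - h(q)\<close> has degree \<open>d deg h > 2 d e\<close>,
    exceeding the degree of the square.\<close>
  have degh: "degree h \<le> 2 * e"
  proof (rule ccontr)
    assume "\<not> ?thesis"
    then have h: "degree h > 2 * e" by simp
    then have "degree h * 2 \<le> degree h * d" using d by simp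
    then have "degree h < degree (pcompose h q)" using h deg_comp[of h] by linarith
    then have "degree (h - pcompose h q) = degree h * d"
      using degree_add_eq_right[of h "- pcompose h q"] by (simp add: deg_comp)
    moreover have "degree (g - pcompose g q) \<le> e * d"
      using d by (intro degree_diff_le) (auto simp: deg_comp e_def)
    then have "degree ((g - pcompose g q)\<^sup>2) \<le> 2 * (e * d)"
      using degree_power_le[of "g - pcompose g q" 2] by (simp add: order.trans mult.commute)
    ultimately have "degree h * d \<le> (2 * e) * d" by (simp add: eq)
    then show False using h d by simp
  qed
  define T where "T = g\<^sup>2 + h"
  define r where "r = T div g"
  define s where "s = T mod g"
  have T: "T = r * g + s" by (simp add: r_def s_def)
  have g0: "g \<noteq> 0" using e by (auto simp: e_def)
  have s: "s = 0 \<or> degree s < e" using degree_mod_less[OF g0, of T] by (auto simp: s_def e_def)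
  have "pcompose T q = pcompose r q * pcompose g q + pcompose s q"
    by (subst T) (simp add: pcompose_add pcompose_mult)
  moreover have "pcompose T q = (pcompose g q)\<^sup>2 + pcompose h q"
    by (simp add: T_def pcompose_add power2_eq_square pcompose_mult)
  moreover have "pcompose h q = h - (g\<^sup>2 - 2 * g * pcompose g q + (pcompose g q)\<^sup>2)"
    unfolding power2_diff[symmetric] using eq by (simp add: power2_eq_square algebra_simps)
  ultimately have key: "(2 * g - pcompose r q) * pcompose g q = g\<^sup>2 - h + pcompose s q"
    by (simp add: algebra_simps)
  have le: "2 * e \<le> e * d" using d by simp
  have "degree (g\<^sup>2) \<le> 2 * e" using degree_power_le[of g 2] by (simp add: e_def mult.commute)
  moreover have "degree (pcompose s q) \<le> e * d" using s by (auto simp: deg_comp)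
  ultimately have "degree (g\<^sup>2 - h + pcompose s q) \<le> e * d"
    using degh le by (intro degree_add_le degree_diff_le; linarith)
  then have "degree (2 * g - pcompose r q) = 0"
  proof (cases "2 * g - pcompose r q = 0")
    case False
    have "pcompose g q \<noteq> 0" using g0 pcompose_eq_0[of g q] q by auto
    then have "degree (2 * g - pcompose r q) + e * d \<le> e * d"
      using \<open>degree (g\<^sup>2 - h + pcompose s q) \<le> e * d\<close> False deg_comp[of g]
      by (simp add: degree_mult_eq e_def flip: key)
    then show ?thesis by simp
  qed simp
  then obtain c where "2 * g - pcompose r q = [:c:]" by (rule degree_eq_zeroE)
  then have "2 * g = pcompose (r + [:c:]) q" by (simp add: pcompose_add algebra_simps)
  then have "smult (inverse 2) (2 * g) = pcompose (smult (inverse 2) (r + [:c:])) q"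
    by (simp add: pcompose_smult)
  moreover have "2 * g = smult 2 g" by (simp add: numeral_poly)
  ultimately have "g = pcompose (smult (inverse 2) (r + [:c:])) q" using two by simp
  then show thesis by (rule that)
qed

text \<open>Descent on \<open>degree g\<close>. Writing \<open>g = g1(q)\<close> gives
  \<open>a = a1(q)\<close> with \<open>a1 = g1 - g1(q)\<close>, and \<open>h = a^2 + h(q)\<close> is
  a polynomial in \<open>q\<close> too. Cancelling the substitution, \<open>a1\<close>,
  \<open>g1\<close>, \<open>h1\<close> satisfy the same equations.\<close>

lemma square_in_image_imp_eq_0:
  assumes two: "(2::'a) \<noteq> 0"
    and "a = g - pcompose g q" "a\<^sup>2 = h - pcompose h q"
  shows "a = 0"
  using assms(2,3)
proof (induction "degree g" arbitrary: a g h rule: less_induct)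
  case less
  show ?case
  proof (cases "degree g = 0")
    case True
    then obtain c where "g = [:c:]" by (rule degree_eq_zeroE)
    then show ?thesis using less.prems by simp
  next
    case False
    then obtain g1 where g1: "g = pcompose g1 q"
      using pcompose_preimage_if_square[OF two, of g h] less.prems by auto
    define a1 where "a1 = g1 - pcompose g1 q"
    have a: "a = pcompose a1 q" by (simp add: less.prems(1) g1 a1_def pcompose_diff)
    define h1 where "h1 = a1\<^sup>2 + h"
    have h: "h = pcompose h1 q"
      using less.prems(2) by (simp add: a h1_def pcompose_add power2_eq_square pcompose_mult)
    have "pcompose (a1\<^sup>2) q = pcompose (h1 - pcompose h1 q) q"
      using less.prems(2) by (simp add: a h[symmetric] pcompose_diff power2_eq_square pcompose_mult)
    then have "a1\<^sup>2 = h1 - pcompose h1 q" by (rule pcompose_inj)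
    moreover have "degree g1 < degree g" using False q by (simp add: g1 degree_pcompose)
    ultimately have "a1 = 0" using less.hyps a1_def by blast
    then show ?thesis by (simp add: a)
  qed
qed

end

section \<open>Images of ideals\<close>

lemma map_poly_to_ac_mult: "map_poly to_ac (f * g) = map_poly to_ac f * map_poly to_ac g"
  by (rule poly_eqI) (simp add: coeff_map_poly coeff_mult to_ac_sum)

lemma map_poly_to_ac_diff: "map_poly to_ac (f - g) = map_poly to_ac f - map_poly to_ac g"
  by (rule poly_eqI) (simp add: coeff_map_poly)

lemma map_poly_to_ac_add: "map_poly to_ac (f + g) = map_poly to_ac f + map_poly to_ac g"
  by (rule poly_eqI) (simp add: coeff_map_poly)

lemma map_poly_to_ac_power: "map_poly to_ac (f ^ n) = map_poly to_ac f ^ n"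
  by (induction n) (simp_all add: map_poly_to_ac_mult)

lemma map_poly_to_ac_pderiv: "map_poly to_ac (pderiv f) = pderiv (map_poly to_ac f)"
  by (rule poly_eqI) (simp add: coeff_map_poly coeff_pderiv)

lemma map_poly_to_ac_pcompose:
  "map_poly to_ac (pcompose f g) = pcompose (map_poly to_ac f) (map_poly to_ac g)"
  by (induction f rule: pCons_induct)
    (simp_all add: pcompose_pCons map_poly_pCons map_poly_to_ac_add map_poly_to_ac_mult)

lemma map_poly_to_ac_eq_iff: "map_poly to_ac f = map_poly to_ac g \<longleftrightarrow> f = g"
  by (simp add: poly_eq_iff coeff_map_poly)

lemma map_poly_to_ac_eq_0_iff: "map_poly to_ac f = 0 \<longleftrightarrow> f = 0"
  using map_poly_to_ac_eq_iff[of f 0] by simp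

lemma pcompose_power: "pcompose (f ^ n) g = pcompose f g ^ n"
  by (induction n) (simp_all add: pcompose_mult pcompose_1)

section \<open>Explicit form of endomorphisms and derivations\<close>

lemma K_linear_0: "K_linear h \<Longrightarrow> h 0 = 0"
  unfolding K_linear_def by (metis smult_0_left)

lemma K_alg_endo_eq_pcompose:
  assumes "K_alg_endo \<phi>"
  shows "\<phi> f = pcompose f (\<phi> [:0, 1:])"
proof (induction f rule: pCons_induct)
  case 0 show ?case using assms by (simp add: K_alg_endo_def K_linear_0)
next
  case (pCons a f)
  have \<phi>: "\<phi> (f + g) = \<phi> f + \<phi> g" "\<phi> (smult c f) = smult c (\<phi> f)" "\<phi> (f * g) = \<phi> f * \<phi> g" "\<phi> 1 = 1" for f g c
    using assms by (auto simp: K_alg_endo_def K_linear_def)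
  have "\<phi> (pCons a f) = \<phi> (smult a 1 + [:0, 1:] * f)" by simp
  also have "\<dots> = smult a 1 + \<phi> [:0, 1:] * \<phi> f" by (simp only: \<phi>)
  also have "\<dots> = pcompose (pCons a f) (\<phi> [:0, 1:])"
    unfolding pCons.IH pcompose_pCons by simp
  finally show ?case .
qed

lemma K_derivation_eq_pderiv_mult:
  assumes "K_derivation D"
  shows "D f = pderiv f * D [:0, 1:]"
proof (induction f rule: pCons_induct)
  case 0 show ?case using assms by (simp add: K_derivation_def K_linear_0)
next
  case (pCons a f)
  have D: "D (f + g) = D f + D g" "D (smult c f) = smult c (D f)" "D (f * g) = D f * g + f * D g" for f g c
    using assms by (auto simp: K_derivation_def K_linear_def)
  have "D 1 = D 1 + D 1" using D(3)[of 1 1] by (simp only: mult_1_left mult_1_right)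
  then have D1: "D 1 = 0" by (simp only: add_cancel_right_right)
  have "D (pCons a f) = D (smult a 1 + [:0, 1:] * f)" by simp
  also have "\<dots> = smult a (D 1) + (D [:0, 1:] * f + [:0, 1:] * D f)"
    unfolding D(1) D(2)[of a 1] D(3) ..
  also have "\<dots> = D [:0, 1:] * f + [:0, 1:] * (pderiv f * D [:0, 1:])"
    using D1 pCons.IH by simp
  also have "\<dots> = pderiv (pCons a f) * D [:0, 1:]" by (simp add: pderiv_pCons algebra_simps)
  finally show ?case .
qed

text \<open>\<open>D\<close> is \<open>w\<close> times the derivative. If \<open>w\<close> is
  non-constant, \<open>D\<close> preserves positivity of the degree, so no iterate kills
  \<open>x\<close>.\<close>

lemma locally_nilpotent_derivation_eq:
  fixes D :: "'a::field_char_0 poly \<Rightarrow> 'a poly"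
  assumes "K_derivation D" "locally_nilpotent D"
  obtains c where "D = (\<lambda>f. smult c (pderiv f))"
proof -
  define w where "w = D [:0, 1:]"
  have D: "D f = pderiv f * w" for f unfolding w_def using assms(1) by (rule K_derivation_eq_pderiv_mult)
  have "degree w = 0"
  proof (rule ccontr)
    assume w: "degree w \<noteq> 0"
    have "degree ((D ^^ m) [:0, 1:]) > 0" for m
    proof (induction m)
      case (Suc m)
      define f where "f = (D ^^ m) [:0, 1:]"
      have "degree f > 0" using Suc by (simp add: f_def)
      then have "pderiv f \<noteq> 0" by (simp add: pderiv_eq_0_iff)
      then have "degree (D f) = degree (pderiv f) + degree w"
        unfolding D using w by (intro degree_mult_eq) auto
      then show ?case using w by (simp add: f_def)
    qed simp
    moreover obtain m where "(D ^^ m) [:0, 1:] = 0" using assms(2) unfolding locally_nilpotent_def by blast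
    ultimately show False by (metis degree_0 less_irrefl)
  qed
  then obtain c where "w = [:c:]" by (rule degree_eq_zeroE)
  then have "D = (\<lambda>f. smult c (pderiv f))" by (simp add: fun_eq_iff D)
  then show thesis by (rule that)
qed

section \<open>Criteria for Mathieu subspaces, and principal ideals\<close>

lemma K_subspace_image:
  assumes "poly_ideal I" "K_linear \<delta>"
  shows "K_subspace (\<delta> ` I)"
  unfolding K_subspace_def
proof (intro conjI ballI allI)
  have I: "0 \<in> I" "\<And>f g. f \<in> I \<Longrightarrow> g \<in> I \<Longrightarrow> f + g \<in> I" "\<And>f g. f \<in> I \<Longrightarrow> g * f \<in> I"
    using assms(1) by (auto simp: poly_ideal_def)
  show "0 \<in> \<delta> ` I" using I(1) K_linear_0[OF assms(2)] by (metis imageI)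
  show "f + g \<in> \<delta> ` I" if fg: "f \<in> \<delta> ` I" "g \<in> \<delta> ` I" for f g
  proof -
    obtain f' g' where "f' \<in> I" "g' \<in> I" "f = \<delta> f'" "g = \<delta> g'" using fg by blast
    then show ?thesis using I(2)[of f' g'] assms(2) by (metis K_linear_def imageI)
  qed
  show "smult c f \<in> \<delta> ` I" if f: "f \<in> \<delta> ` I" for c f
  proof -
    obtain f' where "f' \<in> I" "f = \<delta> f'" using f by blast
    then have "smult c f' \<in> I" "smult c f = \<delta> (smult c f')"
      using I(3)[of f' "[:c:]"] assms(2) by (simp_all add: K_linear_def)
    then show ?thesis by blast
  qed
qed

lemma mathieu_subspaceI_no_powers:
  assumes "K_subspace V" and zero: "\<And>a. (\<And>m. m \<ge> 1 \<Longrightarrow> a ^ m \<in> V) \<Longrightarrow> a = 0"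
  shows "mathieu_subspace V"
  unfolding mathieu_subspace_def
proof (intro conjI allI impI assms(1))
  fix a b assume "\<forall>m\<ge>1. a ^ m \<in> V"
  then have "a = 0" using zero by blast
  have "0 \<in> V" using assms(1) by (simp add: K_subspace_def)
  \<comment> \<open>The exponent 0 is excluded because \<open>0 ^ 0 = 1\<close>.\<close>
  then have "\<forall>m\<ge>1. a ^ m * b \<in> V" by (simp add: \<open>a = 0\<close> power_0_left)
  then show "\<exists>N. \<forall>m\<ge>N. a ^ m * b \<in> V" by blast
qed

lemma mathieu_subspaceI_ideal:
  assumes "K_subspace V" and ideal: "\<And>f g. f \<in> V \<Longrightarrow> f * g \<in> V"
  shows "mathieu_subspace V"
  unfolding mathieu_subspace_def using assms by blast

lemma poly_ideal_principal:
  fixes I :: "'a::field poly set"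
  assumes "poly_ideal I"
  obtains u where "I = range (\<lambda>f. u * f)"
proof -
  have I: "0 \<in> I" "\<And>f g. f \<in> I \<Longrightarrow> g \<in> I \<Longrightarrow> f + g \<in> I" "\<And>f g. f \<in> I \<Longrightarrow> g * f \<in> I"
    using assms by (auto simp: poly_ideal_def)
  show thesis
  proof (cases "I \<subseteq> {0}")
    case True
    then have "I = range (\<lambda>f. 0 * f)" using I(1) by auto
    then show thesis by (rule that)
  next
    case False
    then obtain u where u: "u \<in> I" "u \<noteq> 0" and min: "\<And>v. v \<in> I \<Longrightarrow> v \<noteq> 0 \<Longrightarrow> degree u \<le> degree v"
      using arg_min_nat_lemma[of "\<lambda>u. u \<in> I \<and> u \<noteq> 0" _ degree] by blast
    have "I = range (\<lambda>f. u * f)"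
    proof
      show "range (\<lambda>f. u * f) \<subseteq> I" using I(3)[OF u(1)] by (auto simp: mult.commute)
      show "I \<subseteq> range (\<lambda>f. u * f)"
      proof
        fix f assume f: "f \<in> I"
        have "f mod u = f + (- (f div u)) * u" by (simp add: minus_div_mult_eq_mod[symmetric])
        then have "f mod u \<in> I" using I(2)[OF f I(3)[OF u(1)]] by metis
        then have "f mod u = 0" using min degree_mod_less[OF u(2), of f] by force
        then have "f = u * (f div u)" by auto
        then show "f \<in> range (\<lambda>f. u * f)" by blast
      qed
    qed
    then show thesis by (rule that)
  qed
qed

section \<open>Images of ideals under the derivative\<close>

text \<open>Expanding \<open>h\<close> in powers of \<open>x - s\<close> and integrating termwise
  from \<open>s\<close> gains one factor \<open>x - s\<close>; synthetic division carries out the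
  expansion by induction on the degree.\<close>

lemma exists_antiderivative_power_mult:
  fixes h :: "'a::field_char_0 poly"
  shows "\<exists>G. pderiv ([:- s, 1:] ^ Suc k * G) = [:- s, 1:] ^ k * h"
proof (induction "degree h" arbitrary: h k rule: less_induct)
  case less
  define l where "l = [:- s, 1:]"
  have pd: "pderiv (l ^ Suc k * [:b / of_nat (Suc k):]) = l ^ k * [:b:]" for b
  proof -
    have "pderiv (l ^ Suc k * [:b / of_nat (Suc k):]) = smult (b / of_nat (Suc k)) (pderiv (l ^ Suc k))"
      by (simp add: pderiv_smult del: power_Suc of_nat_Suc)
    also have "pderiv (l ^ Suc k) = smult (of_nat (Suc k)) (l ^ k)"
      unfolding pderiv_power_Suc by (simp add: l_def pderiv_pCons)
    finally show ?thesis by (simp del: of_nat_Suc)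
  qed
  show ?case
  proof (cases "degree h = 0")
    case True
    then obtain b where "h = [:b:]" by (rule degree_eq_zeroE)
    then show ?thesis using pd[of b] unfolding l_def by blast
  next
    case False
    define h' where "h' = synthetic_div h s"
    have h: "h = l * h' + [:poly h s:]" unfolding l_def h'_def by (rule synthetic_div_correct'[symmetric])
    have "degree h' < degree h" using False by (simp add: h'_def degree_synthetic_div)
    then obtain G where G: "pderiv (l ^ Suc (Suc k) * G) = l ^ Suc k * h'"
      using less unfolding l_def by blast
    have "pderiv (l ^ Suc k * ([:poly h s / of_nat (Suc k):] + l * G))
        = pderiv (l ^ Suc k * [:poly h s / of_nat (Suc k):]) + pderiv (l ^ Suc (Suc k) * G)"
      by (simp only: distrib_left pderiv_add) (simp only: power_Suc mult_ac)
    also have "\<dots> = l ^ k * (l * h' + [:poly h s:])"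
      unfolding pd G by (simp add: algebra_simps)
    finally show ?thesis unfolding h[symmetric] unfolding l_def by blast
  qed
qed

text \<open>For non-constant \<open>u\<close>, a single root \<open>r\<close> in the algebraic
  closure gives \<open>u = c (x - r)^n\<close> there. The coefficient at \<open>n - 1\<close> is
  \<open>- c n r\<close>, so \<open>r\<close> lies in the base field, as \<open>n\<close> is
  invertible.\<close>

lemma unique_root_imp_power:
  fixes u :: "'a::field_char_0 poly"
  assumes "u \<noteq> 0" and unique: "\<And>r r'. poly (map_poly to_ac u) r = 0 \<Longrightarrow> poly (map_poly to_ac u) r' = 0 \<Longrightarrow> r = r'"
  obtains c s n where "c \<noteq> 0" "u = smult c ([:- s, 1:] ^ n)"
proof (cases "degree u = 0")
  case True
  then obtain c where "u = [:c:]" by (rule degree_eq_zeroE)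
  then show thesis using that[of c 0 0] assms(1) by simp
next
  case False
  define v where "v = map_poly to_ac u"
  have v0: "v \<noteq> 0" using assms(1) by (simp add: v_def map_poly_to_ac_eq_0_iff)
  have "degree v = degree u" unfolding v_def using assms(1) by (intro map_poly_degree_eq) simp
  then obtain r where r: "poly v r = 0" using False alg_closed_imp_poly_has_root[of v] by auto
  define n where "n = order r v"
  obtain w where w: "v = [:- r, 1:] ^ n * w" "\<not> [:- r, 1:] dvd w"
    using order_decomp[OF v0, of r] by (auto simp: n_def)
  have "poly w r \<noteq> 0" using w(2) by (simp add: poly_eq_0_iff_dvd)
  have "degree w = 0"
  proof (rule ccontr)
    assume "degree w \<noteq> 0"
    then obtain r' where r': "poly w r' = 0" using alg_closed_imp_poly_has_root[of w] by auto
    then have "poly v r' = 0" by (simp add: w)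
    then have "r' = r" using unique r by (simp add: v_def)
    then show False using r' \<open>poly w r \<noteq> 0\<close> by simp
  qed
  then obtain c where c: "w = [:c:]" by (rule degree_eq_zeroE)
  have "c \<noteq> 0" using v0 by (auto simp: w c)
  have v: "v = smult c ([:- r, 1:] ^ n)" by (simp add: w c)
  have "n \<noteq> 0" using r by (cases n) (auto simp: v \<open>c \<noteq> 0\<close>)
  have coeff_v: "coeff v i = c * (of_nat (n choose i) * 1 ^ i * (- r) ^ (n - i))" if "i \<le> n" for i
    unfolding v coeff_smult using coeff_linear_poly_power[OF that, of "- r" 1] by simp
  have vn: "c = to_ac (coeff u n)" using coeff_v[of n] by (simp add: v_def coeff_map_poly)
  have "n choose (n - 1) = n" using \<open>n \<noteq> 0\<close> binomial_symmetric[of 1 n] by simp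
  then have "to_ac (coeff u (n - 1)) = - (c * of_nat n * r)"
    using coeff_v[of "n - 1"] \<open>n \<noteq> 0\<close> by (simp add: v_def coeff_map_poly)
  define s where "s = - (coeff u (n - 1) / (of_nat n * coeff u n))"
  have rs: "r = to_ac s"
    using \<open>to_ac (coeff u (n - 1)) = _\<close> \<open>c \<noteq> 0\<close> \<open>n \<noteq> 0\<close> by (simp add: s_def vn field_simps)
  have "map_poly to_ac u = map_poly to_ac (smult (coeff u n) ([:- s, 1:] ^ n))"
    unfolding v_def[symmetric] v vn rs
    by (simp add: map_poly_smult map_poly_to_ac_power map_poly_pCons)
  then have "u = smult (coeff u n) ([:- s, 1:] ^ n)" by (simp only: map_poly_to_ac_eq_iff)
  moreover have "coeff u n \<noteq> 0" using \<open>c \<noteq> 0\<close> vn by auto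
  ultimately show thesis by (rule that[rotated])
qed

lemma mathieu_subspace_0: "mathieu_subspace {0}"
  by (rule mathieu_subspaceI_ideal) (auto simp: K_subspace_def)

lemma K_linear_pderiv: "K_linear pderiv"
  by (simp add: K_linear_def pderiv_add pderiv_smult)

text \<open>The substitution \<open>l\<close> sends 0 and 1 to the roots \<open>r\<close> and
  \<open>r'\<close>, reducing the claim to \<open>power_integrals_eq_0_imp_eq_0\<close> over the
  algebraic closure.\<close>

lemma pderiv_powers_eq_0:
  fixes u a :: "'a::field_char_0 poly"
  assumes powers: "\<And>m. m \<ge> 1 \<Longrightarrow> a ^ m \<in> pderiv ` range (\<lambda>f. u * f)"
    and r: "poly (map_poly to_ac u) r = 0" "poly (map_poly to_ac u) r' = 0" "r \<noteq> r'"
  shows "a = 0"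
proof -
  define l where "l = [:r, r' - r:]"
  define b where "b = pcompose (map_poly to_ac a) l"
  have "b = 0"
  proof (rule power_integrals_eq_0_imp_eq_0)
    fix m :: nat assume "m > 0"
    then have "m \<ge> 1" by simp
    then obtain f where f: "a ^ m = pderiv (u * f)" using powers by blast
    define g where "g = map_poly to_ac (u * f)"
    have g: "pderiv g = map_poly to_ac a ^ m" unfolding g_def
      by (simp only: map_poly_to_ac_pderiv[symmetric] f[symmetric] map_poly_to_ac_power)
    have g0: "poly g r = 0" "poly g r' = 0" using r by (simp_all add: g_def map_poly_to_ac_mult)
    \<comment> \<open>The scalar cancels the derivative of \<open>l\<close> from the chain
      rule.\<close>
    define H where "H = smult (inverse (r' - r)) (pcompose g l)"
    have "pderiv H = smult (inverse (r' - r)) (pcompose (map_poly to_ac a ^ m) l * [:r' - r:])"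
      unfolding H_def pderiv_smult pderiv_pcompose g by (simp add: l_def pderiv_pCons)
    also have "\<dots> = b ^ m" using r(3) by (simp add: b_def pcompose_power)
    finally have "pderiv H = b ^ m" .
    moreover have "poly H 0 = 0" "poly H 1 = 0" using g0 by (simp_all add: H_def l_def poly_pcompose)
    ultimately show "\<exists>H. pderiv H = b ^ m \<and> poly H 0 = 0 \<and> poly H 1 = 0" by blast
  qed
  then have "map_poly to_ac a = 0"
    unfolding b_def by (rule pcompose_eq_0) (simp add: l_def r(3)[symmetric])
  then show ?thesis by (simp add: map_poly_to_ac_eq_0_iff)
qed

lemma mathieu_subspace_pderiv_image:
  fixes I :: "'a::field_char_0 poly set"
  assumes "poly_ideal I"
  shows "mathieu_subspace (pderiv ` I)"
proof -
  obtain u where u: "I = range (\<lambda>f. u * f)" using assms by (rule poly_ideal_principal)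
  have sub: "K_subspace (pderiv ` I)" using assms K_linear_pderiv by (rule K_subspace_image)
  consider "u = 0"
    | r r' where "poly (map_poly to_ac u) r = 0" "poly (map_poly to_ac u) r' = 0" "r \<noteq> r'"
    | "u \<noteq> 0" "\<And>r r'. poly (map_poly to_ac u) r = 0 \<Longrightarrow> poly (map_poly to_ac u) r' = 0 \<Longrightarrow> r = r'"
    by blast
  then show ?thesis
  proof cases
    case 1
    then have "pderiv ` I = {0}" by (auto simp: u)
    then show ?thesis by (simp add: mathieu_subspace_0)
  next
    case (2 r r')
    show ?thesis using sub
    proof (rule mathieu_subspaceI_no_powers)
      fix a assume "\<And>m. m \<ge> 1 \<Longrightarrow> a ^ m \<in> pderiv ` I"
      then show "a = 0" unfolding u using 2 by (rule pderiv_powers_eq_0)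
    qed
  next
    case 3
    obtain c s n where c: "c \<noteq> 0" and un: "u = smult c ([:- s, 1:] ^ n)"
      by (rule unique_root_imp_power[OF 3])
    define l where "l = [:- s, 1:]"
    have ul: "u = smult c (l ^ n)" by (simp add: un l_def)
    show ?thesis using sub
    proof (rule mathieu_subspaceI_ideal)
      fix f g assume "f \<in> pderiv ` I"
      then obtain h where h: "f = pderiv (u * h)" by (auto simp: u)
      \<comment> \<open>Differentiation costs at most one factor \<open>l\<close>; conversely every
        multiple of \<open>l ^ (n - 1)\<close> has an antiderivative in \<open>I\<close>.\<close>
      have "l ^ (n - 1) dvd f"
      proof (cases n)
        case (Suc k)
        have "f = smult c (pderiv (l ^ n) * h + l ^ n * pderiv h)"
          by (simp add: h ul pderiv_smult pderiv_mult algebra_simps)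
        moreover have "l ^ k dvd pderiv (l ^ n)" unfolding Suc pderiv_power_Suc
          by (intro dvd_mult2 dvd_smult) simp
        moreover have "l ^ k dvd l ^ n" by (simp add: Suc le_imp_power_dvd)
        ultimately show ?thesis by (simp add: Suc dvd_smult)
      qed simp
      then have "l ^ (n - 1) dvd f * g" by (rule dvd_mult2)
      then obtain k where k: "f * g = l ^ (n - 1) * k" by (rule dvdE)
      \<comment> \<open>\<open>Suc (n - 1)\<close> is \<open>n\<close>, or 1 if
        \<open>n = 0\<close>; in both cases the antiderivative is a multiple of
        \<open>u\<close>.\<close>
      obtain G where G: "pderiv (l ^ Suc (n - 1) * G) = f * g"
        unfolding k l_def using exists_antiderivative_power_mult by blast
      have "u dvd l ^ Suc (n - 1) * G"
      proof -
        have "l ^ n dvd l ^ Suc (n - 1)" by (rule le_imp_power_dvd) simp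
        then show ?thesis unfolding ul using c by (intro smult_dvd) (auto intro: dvd_mult2)
      qed
      then obtain k' where "l ^ Suc (n - 1) * G = u * k'" by blast
      then have "f * g = pderiv (u * k')" using G by simp
      then show "f * g \<in> pderiv ` I" by (auto simp: u)
    qed
  qed
qed

section \<open>Images of ideals under differences of translations\<close>

text \<open>The substitution \<open>l\<close> moves the repeated root \<open>\<alpha>\<close> to 0
  and turns translation by \<open>k\<close> into translation by 1; every multiple of
  \<open>u\<close> has derivative 0 at \<open>\<alpha>\<close>.\<close>

lemma translation_powers_eq_0:
  fixes u a :: "'a::field_char_0 poly"
  assumes powers: "\<And>m. m \<ge> 1 \<Longrightarrow> a ^ m \<in> (\<lambda>f. f - pcompose f [:c, 1:]) ` range (\<lambda>f. u * f)"
    and "c \<noteq> 0" and dvd: "[:- \<alpha>, 1:]\<^sup>2 dvd map_poly to_ac u"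
  shows "a = 0"
proof -
  define k where "k = to_ac c"
  have "k \<noteq> 0" using \<open>c \<noteq> 0\<close> by (simp add: k_def)
  define l where "l = [:\<alpha>, k:]"
  define b where "b = pcompose (map_poly to_ac a) l"
  have "b = 0"
  proof (rule power_differences_eq_0_imp_eq_0)
    fix m :: nat assume "m > 0"
    then have "m \<ge> 1" by simp
    then obtain f where f: "a ^ m = u * f - pcompose (u * f) [:c, 1:]" using powers by blast
    define g where "g = map_poly to_ac (u * f)"
    have "map_poly to_ac (a ^ m) = g - pcompose g [:k, 1:]"
      unfolding f map_poly_to_ac_diff map_poly_to_ac_pcompose g_def
      by (simp add: map_poly_pCons k_def)
    then have g: "map_poly to_ac a ^ m = g - pcompose g [:k, 1:]" by (simp add: map_poly_to_ac_power)
    \<comment> \<open>The sign accounts for \<open>g - g(x + k)\<close> against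
      \<open>H(x + 1) - H(x)\<close>.\<close>
    define H where "H = - pcompose g l"
    have "pcompose l [:1, 1:] = pcompose [:k, 1:] l" by (simp add: l_def pcompose_pCons)
    then have "pcompose H [:1, 1:] - H = pcompose (g - pcompose g [:k, 1:]) l"
      by (simp add: H_def pcompose_uminus pcompose_diff flip: pcompose_assoc)
    also have "\<dots> = b ^ m" by (simp add: b_def pcompose_power flip: g)
    finally have "pcompose H [:1, 1:] - H = b ^ m" .
    moreover have "poly (pderiv H) 0 = 0"
    proof -
      obtain v where "map_poly to_ac u = [:- \<alpha>, 1:]\<^sup>2 * v" using dvd by blast
      then have "g = [:- \<alpha>, 1:] * ([:- \<alpha>, 1:] * (v * map_poly to_ac f))"
        by (simp only: g_def map_poly_to_ac_mult power2_eq_square mult.assoc)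
      then have "poly (pderiv g) \<alpha> = 0" by (simp only: pderiv_mult) simp
      then show ?thesis by (simp add: H_def pderiv_minus pderiv_pcompose poly_pcompose l_def)
    qed
    ultimately show "\<exists>H. pcompose H [:1, 1:] - H = b ^ m \<and> poly (pderiv H) 0 = 0" by blast
  qed
  then have "map_poly to_ac a = 0"
    unfolding b_def by (rule pcompose_eq_0) (simp add: l_def \<open>k \<noteq> 0\<close>)
  then show ?thesis by (simp add: map_poly_to_ac_eq_0_iff)
qed

text \<open>Conjugation by the scaling \<open>l\<close> reduces this to translation by 1.\<close>

lemma translation_difference_surj:
  fixes g :: "'a::field_char_0 poly"
  assumes "c \<noteq> 0"
  obtains f where "f - pcompose f [:c, 1:] = g"
proof -
  define l l' where "l = [:0, c:]" and "l' = [:0, inverse c:]"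
  obtain H where H: "pcompose H [:1, 1:] - H = - pcompose g l"
    using exists_difference_preimage by blast
  have "pcompose l' [:c, 1:] = pcompose [:1, 1:] l'" using assms by (simp add: l'_def pcompose_pCons)
  then have "pcompose H l' - pcompose (pcompose H l') [:c, 1:] = - pcompose (pcompose H [:1, 1:] - H) l'"
    by (simp add: pcompose_diff flip: pcompose_assoc)
  also have "\<dots> = pcompose g (pcompose l l')" unfolding H by (simp add: pcompose_uminus pcompose_assoc)
  also have "pcompose l l' = [:0, 1:]" using assms by (simp add: l_def l'_def pcompose_pCons)
  finally show thesis using that by simp
qed

lemma K_linear_pcompose_difference: "K_linear (\<lambda>f. f - pcompose f q)"
  by (simp add: K_linear_def pcompose_add pcompose_smult smult_diff_right)

lemma mathieu_subspace_translation_image: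
  fixes u :: "'a::field_char_0 poly"
  assumes I: "poly_ideal I" "I = range (\<lambda>f. u * f)"
    and u: "u = 0 \<or> degree u \<le> 1 \<or> (\<exists>\<alpha>. order \<alpha> (map_poly to_ac u) \<ge> 2)"
  shows "mathieu_subspace ((\<lambda>f. f - pcompose f [:c, 1:]) ` I)"
proof -
  let ?\<delta> = "\<lambda>f. f - pcompose f [:c, 1:]"
  have sub: "K_subspace (?\<delta> ` I)" using I(1) K_linear_pcompose_difference by (rule K_subspace_image)
  consider "u = 0 \<or> c = 0" | "c \<noteq> 0" "u \<noteq> 0" "degree u \<le> 1"
    | \<alpha> where "c \<noteq> 0" "order \<alpha> (map_poly to_ac u) \<ge> 2" using u by blast
  then show ?thesis
  proof cases
    case 1
    then have "?\<delta> ` I = {0}" by (auto simp: I(2) image_image)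
    then show ?thesis by (simp add: mathieu_subspace_0)
  next
    case 2
    have "g \<in> ?\<delta> ` I" for g
    proof -
      obtain f where f: "?\<delta> f = g" using translation_difference_surj[OF \<open>c \<noteq> 0\<close>] by blast
      \<comment> \<open>Division by \<open>u\<close> leaves a constant, which the difference
        operator annihilates; so \<open>f\<close> may be replaced by a multiple of
        \<open>u\<close>.\<close>
      have "degree (f mod u) = 0" using degree_mod_less[OF \<open>u \<noteq> 0\<close>, of f] 2(3) by auto
      then obtain b where b: "f mod u = [:b:]" by (rule degree_eq_zeroE)
      have "u * (f div u) = f - [:b:]" by (simp add: minus_mod_eq_mult_div flip: b)
      then have "?\<delta> (u * (f div u)) = g" by (simp add: pcompose_diff f)
      then show ?thesis by (auto simp: I(2))
    qed
    then show ?thesis by (intro mathieu_subspaceI_ideal[OF sub]) auto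
  next
    case (3 \<alpha>)
    have "[:- \<alpha>, 1:]\<^sup>2 dvd map_poly to_ac u"
      using order_1[of \<alpha> "map_poly to_ac u"] le_imp_power_dvd[OF 3(2)] by (rule dvd_trans[rotated])
    show ?thesis using sub
    proof (rule mathieu_subspaceI_no_powers)
      fix a assume "\<And>m. m \<ge> 1 \<Longrightarrow> a ^ m \<in> ?\<delta> ` I"
      then show "a = 0" unfolding I(2) using 3(1) \<open>[:- \<alpha>, 1:]\<^sup>2 dvd _\<close> by (rule translation_powers_eq_0)
    qed
  qed
qed

theorem theorem1p6:
  fixes I :: "'a::field_char_0 poly set"
    and \<delta> :: "'a poly \<Rightarrow> 'a poly"
  assumes "poly_ideal I"
    and "K_derivation \<delta> \<or> K_E_derivation \<delta>"
    and "(K_derivation \<delta> \<and> locally_nilpotent \<delta>)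
         \<or> (\<exists>\<phi>. K_alg_endo \<phi> \<and> \<delta> = (\<lambda>f. f - \<phi> f) \<and> degree (\<phi> [:0, 1:]) \<ge> 2)
         \<or> (\<exists>\<phi> c u. K_alg_endo \<phi> \<and> \<delta> = (\<lambda>f. f - \<phi> f) \<and> \<phi> [:0, 1:] = [:c, 1:]
               \<and> I = range (\<lambda>f. u * f)
               \<and> (u = 0 \<or> degree u \<le> 1
                  \<or> (\<exists>\<alpha> :: 'a alg_closure. order \<alpha> (map_poly to_ac u) \<ge> 2)))"
  shows "mathieu_subspace (\<delta> ` I)"
proof -
  consider (derivation) "K_derivation \<delta>" "locally_nilpotent \<delta>"
    | (composition) \<phi> where "K_alg_endo \<phi>" "\<delta> = (\<lambda>f. f - \<phi> f)" "degree (\<phi> [:0, 1:]) \<ge> 2"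
    | (translation) \<phi> c u where "K_alg_endo \<phi>" "\<delta> = (\<lambda>f. f - \<phi> f)" "\<phi> [:0, 1:] = [:c, 1:]"
      "I = range (\<lambda>f. u * f)"
      "u = 0 \<or> degree u \<le> 1 \<or> (\<exists>\<alpha> :: 'a alg_closure. order \<alpha> (map_poly to_ac u) \<ge> 2)"
    using assms(3) by blast
  then show ?thesis
  proof cases
    case derivation
    then obtain c where \<delta>: "\<delta> = (\<lambda>f. smult c (pderiv f))" by (rule locally_nilpotent_derivation_eq)
    have I: "smult b f \<in> I" if "f \<in> I" for b f
    proof -
      have "[:b:] * f \<in> I" using assms(1) that unfolding poly_ideal_def by blast
      then show ?thesis by simp
    qed
    show ?thesis
    proof (cases "c = 0")
      case True
      then have "\<delta> ` I = {0}" using assms(1) by (auto simp: \<delta> poly_ideal_def)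
      then show ?thesis by (simp add: mathieu_subspace_0)
    next
      case False
      \<comment> \<open>\<open>I\<close> is stable under scaling by \<open>c\<close> and by
        \<open>1 / c\<close>, so the constant factor does not change the image.\<close>
      have "\<delta> ` I = pderiv ` I"
      proof (intro subset_antisym image_subsetI)
        fix f assume f: "f \<in> I"
        show "\<delta> f \<in> pderiv ` I"
          using I[OF f, of c] by (intro image_eqI[of _ _ "smult c f"]) (simp_all add: \<delta> pderiv_smult)
        show "pderiv f \<in> \<delta> ` I"
          using I[OF f, of "inverse c"] False by (intro image_eqI[of _ _ "smult (inverse c) f"]) (simp_all add: \<delta> pderiv_smult)
      qed
      then show ?thesis using mathieu_subspace_pderiv_image[OF assms(1)] by simp
    qed
  next
    case composition
    note \<phi> = composition
    define q where "q = \<phi> [:0, 1:]"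
    have \<delta>: "\<delta> = (\<lambda>f. f - pcompose f q)"
      unfolding \<phi>(2) q_def by (intro ext arg_cong2[where f="(-)"] refl K_alg_endo_eq_pcompose[OF \<phi>(1)])
    have sub: "K_subspace (\<delta> ` I)"
      unfolding \<delta> using assms(1) K_linear_pcompose_difference by (rule K_subspace_image)
    then show ?thesis
    proof (rule mathieu_subspaceI_no_powers)
      fix a assume powers: "\<And>m. m \<ge> 1 \<Longrightarrow> a ^ m \<in> \<delta> ` I"
      obtain g h where "a ^ 1 = \<delta> g" "a ^ 2 = \<delta> h" using powers[of 1] powers[of 2] by auto
      then show "a = 0" using square_in_image_imp_eq_0[of q a g h] \<phi>(3) by (simp add: \<delta> q_def)
    qed
  next
    case translation
    note \<phi> = translation(1-3) and u = translation(4,5)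
    have "\<delta> = (\<lambda>f. f - pcompose f [:c, 1:])"
      unfolding \<phi>(2)
      by (intro ext arg_cong2[where f="(-)"] refl K_alg_endo_eq_pcompose[OF \<phi>(1), unfolded \<phi>(3)])
    then show ?thesis using mathieu_subspace_translation_image[OF assms(1) u] by simp
  qed
qed

end
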